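(* Let $S_{\boldsymbol\lambda}\in\boldsymbol B(\ell^2(V))$ be a weighted shift on a directed tree $\mathcal T=(V,E)$ with weights $\boldsymbol\lambda=\{\lambda_v\}_{v\in V^\circ}$, and let $p$ be a positive real number. Then the following assertions are equivalent: (i) $S_{\boldsymbol\lambda}$ is $p$-hyponormal; (ii) the following two conditions hold: $$\text{for every }u\in V,\text{ if }v\in\operatorname{Chi}(u)\text{ and }\|S_{\boldsymbol\lambda}e_v\|=0,\text{ then }\lambda_v=0,$$ $$\|S_{\boldsymbol\lambda}e_u\|^{2(p-1)}\sum_{v\in\operatorname{Chi}^+_{\boldsymbol\lambda}(u)}\frac{|\lambda_v|^2}{\|S_{\boldsymbol\lambda}e_v\|^{2p}}\le1,\qquad u\in V^+_{\boldsymbol\lambda},$$ where $V^+_{\boldsymbol\lambda}=\{u\in V:\|S_{\boldsymbol\lambda}e_u\|>0\}$ and $\operatorname{Chi}^+_{\boldsymbol\lambda}(u)=\operatorname{Chi}(u)\cap V^+_{\boldsymbol\lambda}$.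
   Context: A directed tree $\mathcal T=(V,E)$ consists of a nonempty set $V$ (of arbitrary cardinality) of vertices and a set $E\subseteq V\times V\setminus\{(v,v):v\in V\}$ of edges such that: (1) any two distinct vertices $u,v$ are joined by an undirected path, i.e. there are $v_1=u,\dots,v_n=v$ in $V$ ($n\ge 2$) with $(v_j,v_{j+1})\in E$ or $(v_{j+1},v_j)\in E$ for each $j<n$; (2) there is no circuit, i.e. no finite sequence of distinct vertices $u_1,\dots,u_n$ ($n\ge2$) with $(u_j,u_{j+1})\in E$ for $j<n$ and $(u_n,u_1)\in E$; (3) every vertex $v$ that is not a root has a unique vertex $\operatorname{par}(v)$ (its parent) with $(\operatorname{par}(v),v)\in E$; a root is a vertex $v$ for which there is no $u$ with $(u,v)\in E$. A directed tree has at most one root, denoted $\mathrm{root}$ when it exists. $V^\circ$ is $V$ with the root removed (and $V^\circ=V$ if $\mathcal T$ has no root). $\operatorname{Chi}(u)=\{v\in V:(u,v)\in E\}$. $\ell^2(V)$ is the Hilbert space of square summable complex functions on $V$, with orthonormal basis $\{e_u\}_{u\in V}$, $e_u$ being the indicator function of $\{u\}$. For $\boldsymbol\lambda=\{\lambda_v\}_{v\in V^\circ}\subseteq\mathbb C$ and $f\colon V\to\mathbb C$ put $(\Lambda f)(v)=\lambda_v f(\operatorname{par}(v))$ for $v\in V^\circ$ and $(\Lambda f)(\mathrm{root})=0$. The weighted shift $S_{\boldsymbol\lambda}$ is the operator in $\ell^2(V)$ with domain $\{f\in\ell^2(V):\Lambda f\in\ell^2(V)\}$ and $S_{\boldsymbol\lambda}f=\Lambda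 f$. One has $\|S_{\boldsymbol\lambda}e_u\|^2=\sum_{v\in\operatorname{Chi}(u)}|\lambda_v|^2$ (sums over the empty set are $0$). $\boldsymbol B(\mathcal H)$ denotes the bounded operators on $\mathcal H$ with domain $\mathcal H$. For $p>0$, $A\in\boldsymbol B(\mathcal H)$ is $p$-hyponormal if $|A^*|^{2p}\le|A|^{2p}$, where $|A|=(A^*A)^{1/2}$. *)

theory Defs
  imports
    "HOL-Analysis.Analysis"
    "HOL-Computational_Algebra.Polynomial"
    "HOL-Library.FuncSet"
begin

section \<open>Directed trees\<close>

definition is_root :: "'v set \<Rightarrow> ('v \<times> 'v) set \<Rightarrow> 'v \<Rightarrow> bool" where
  "is_root V E v \<longleftrightarrow> v \<in> V \<and> (\<nexists>u. (u, v) \<in> E)"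

locale directed_tree =
  fixes V :: "'v set" and E :: "('v \<times> 'v) set"
  assumes nonempty: "V \<noteq> {}"
    and edges: "E \<subseteq> V \<times> V - {(v, v) | v. v \<in> V}"
    and connected: "\<And>u v. \<lbrakk>u \<in> V; v \<in> V; u \<noteq> v\<rbrakk> \<Longrightarrow>
      \<exists>xs. 2 \<le> length xs \<and> set xs \<subseteq> V \<and> hd xs = u \<and> last xs = v \<and>
        successively (\<lambda>x y. (x, y) \<in> E \<or> (y, x) \<in> E) xs"
    and no_circuit: "\<nexists>xs. 2 \<le> length xs \<and> set xs \<subseteq> V \<and> distinct xs \<and>
        successively (\<lambda>x y. (x, y) \<in> E) xs \<and> (last xs, hd xs) \<in> E"
    and unique_parent: "\<And>v. \<lbrakk>v \<in> V; \<not> is_root V E v\<rbrakk> \<Longrightarrow> \<exists>!u. (u, v) \<in> E"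

definition par :: "('v \<times> 'v) set \<Rightarrow> 'v \<Rightarrow> 'v" where
  "par E v = (THE u. (u, v) \<in> E)"

definition nonroots :: "'v set \<Rightarrow> ('v \<times> 'v) set \<Rightarrow> 'v set" where
  "nonroots V E = V - {v. is_root V E v}"

definition Chi :: "'v set \<Rightarrow> ('v \<times> 'v) set \<Rightarrow> 'v \<Rightarrow> 'v set" where
  "Chi V E u = {v \<in> V. (u, v) \<in> E}"


section \<open>The Hilbert space of square summable functions\<close>

text \<open>
  Functions on \<open>V\<close> are represented by total functions that vanish outside \<open>V\<close>, so that
  equality of functions on \<open>V\<close> is equality in HOL.
\<close>

definition ell2 :: "'v set \<Rightarrow> ('v \<Rightarrow> complex) set" where
  "ell2 V = {f. (\<forall>v. v \<notin> V \<longrightarrow> f v = 0) \<and> (\<lambda>v. (cmod (f v))\<^sup>2) summable_on V}"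

definition ell2_inner :: "'v set \<Rightarrow> ('v \<Rightarrow> complex) \<Rightarrow> ('v \<Rightarrow> complex) \<Rightarrow> complex" where
  "ell2_inner V f g = (\<Sum>\<^sub>\<infinity>v\<in>V. f v * cnj (g v))"

definition ell2_norm :: "'v set \<Rightarrow> ('v \<Rightarrow> complex) \<Rightarrow> real" where
  "ell2_norm V f = sqrt (\<Sum>\<^sub>\<infinity>v\<in>V. (cmod (f v))\<^sup>2)"

definition basis_vec :: "'v \<Rightarrow> 'v \<Rightarrow> complex" where
  "basis_vec u = indicator {u}"


section \<open>Bounded operators\<close>

text \<open>
  An operator with domain \<open>D\<close> is a function that is \<^const>\<open>extensional\<close> on \<open>D\<close>; thus two
  operators defined on all of \<open>\<ell>\<^sup>2(V)\<close> are equal in HOL iff they agree on \<open>\<ell>\<^sup>2(V)\<close>.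
\<close>

type_synonym 'v op = "('v \<Rightarrow> complex) \<Rightarrow> ('v \<Rightarrow> complex)"

definition bounded_ops :: "'v set \<Rightarrow> 'v op set" where
  "bounded_ops V = {T \<in> ell2 V \<rightarrow>\<^sub>E ell2 V.
     (\<forall>f\<in>ell2 V. \<forall>g\<in>ell2 V. T (\<lambda>v. f v + g v) = (\<lambda>v. T f v + T g v)) \<and>
     (\<forall>c. \<forall>f\<in>ell2 V. T (\<lambda>v. c * f v) = (\<lambda>v. c * T f v)) \<and>
     (\<exists>C. \<forall>f\<in>ell2 V. ell2_norm V (T f) \<le> C * ell2_norm V f)}"

definition op_norm :: "'v set \<Rightarrow> 'v op \<Rightarrow> real" where
  "op_norm V T = (SUP f\<in>{f \<in> ell2 V. ell2_norm V f \<le> 1}. ell2_norm V (T f))"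

definition adjoint_op :: "'v set \<Rightarrow> 'v op \<Rightarrow> 'v op" where
  "adjoint_op V T = (THE R. R \<in> bounded_ops V \<and>
     (\<forall>f\<in>ell2 V. \<forall>g\<in>ell2 V. ell2_inner V (T f) g = ell2_inner V f (R g)))"

definition op_le :: "'v set \<Rightarrow> 'v op \<Rightarrow> 'v op \<Rightarrow> bool" where
  "op_le V A B \<longleftrightarrow> (\<forall>f\<in>ell2 V. ell2_inner V (\<lambda>v. B f v - A f v) f \<in> \<real>\<^sub>\<ge>\<^sub>0)"

definition op_poly :: "'v set \<Rightarrow> real poly \<Rightarrow> 'v op \<Rightarrow> 'v op" where
  "op_poly V q T = (\<lambda>f\<in>ell2 V. \<lambda>v. \<Sum>i\<le>degree q. complex_of_real (coeff q i) * (T ^^ i) f v)"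

text \<open>
  Powers \<open>T\<^sup>\<alpha>\<close> with real exponent \<open>\<alpha> > 0\<close> of a positive bounded operator \<open>T\<close>, by the continuous
  functional calculus: \<open>T\<^sup>\<alpha>\<close> is the limit in operator norm of \<open>q\<^sub>n(T)\<close> for every sequence of real
  polynomials \<open>q\<^sub>n\<close> converging to \<open>t \<mapsto> t\<^sup>\<alpha>\<close> uniformly on \<open>[0, \<parallel>T\<parallel>]\<close>, an interval that contains
  the spectrum of \<open>T\<close>. As \<open>0 powr \<alpha> = 0\<close>, the limit function is continuous on this interval.
  The definition is meaningful only for positive \<open>T\<close> and \<open>\<alpha> > 0\<close>.
\<close>

definition op_powr :: "'v set \<Rightarrow> 'v op \<Rightarrow> real \<Rightarrow> 'v op" where
  "op_powr V T \<alpha> = (THE R. R \<in> bounded_ops V \<and>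
     (\<forall>q :: nat \<Rightarrow> real poly.
        uniform_limit {0..op_norm V T} (\<lambda>n t. poly (q n) t) (\<lambda>t. t powr \<alpha>) sequentially \<longrightarrow>
        (\<lambda>n. op_norm V (\<lambda>f v. op_poly V (q n) T f v - R f v)) \<longlonglongrightarrow> 0))"

definition op_abs :: "'v set \<Rightarrow> 'v op \<Rightarrow> 'v op" where
  "op_abs V A = op_powr V (compose (ell2 V) (adjoint_op V A) A) (1 / 2)"

definition p_hyponormal :: "'v set \<Rightarrow> real \<Rightarrow> 'v op \<Rightarrow> bool" where
  "p_hyponormal V p A \<longleftrightarrow>
     op_le V (op_powr V (op_abs V (adjoint_op V A)) (2 * p)) (op_powr V (op_abs V A) (2 * p))"


section \<open>Weighted shifts on directed trees\<close>

text \<open>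
  Weights are total functions; only their values on \<^term>\<open>nonroots V E\<close> are ever used.
\<close>

definition shift_map :: "'v set \<Rightarrow> ('v \<times> 'v) set \<Rightarrow> ('v \<Rightarrow> complex) \<Rightarrow> 'v op" where
  "shift_map V E l f = (\<lambda>v. if v \<in> nonroots V E then l v * f (par E v) else 0)"

definition shift_domain ::
    "'v set \<Rightarrow> ('v \<times> 'v) set \<Rightarrow> ('v \<Rightarrow> complex) \<Rightarrow> ('v \<Rightarrow> complex) set" where
  "shift_domain V E l = {f \<in> ell2 V. shift_map V E l f \<in> ell2 V}"

definition weighted_shift :: "'v set \<Rightarrow> ('v \<times> 'v) set \<Rightarrow> ('v \<Rightarrow> complex) \<Rightarrow> 'v op" where
  "weighted_shift V E l = restrict (shift_map V E l) (shift_domain V E l)"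

definition shift_norm :: "'v set \<Rightarrow> ('v \<times> 'v) set \<Rightarrow> ('v \<Rightarrow> complex) \<Rightarrow> 'v \<Rightarrow> real" where
  "shift_norm V E l u = ell2_norm V (weighted_shift V E l (basis_vec u))"

definition V_plus :: "'v set \<Rightarrow> ('v \<times> 'v) set \<Rightarrow> ('v \<Rightarrow> complex) \<Rightarrow> 'v set" where
  "V_plus V E l = {u \<in> V. shift_norm V E l u > 0}"

definition Chi_plus :: "'v set \<Rightarrow> ('v \<times> 'v) set \<Rightarrow> ('v \<Rightarrow> complex) \<Rightarrow> 'v \<Rightarrow> 'v set" where
  "Chi_plus V E l u = Chi V E u \<inter> V_plus V E l"

end

theory Submission
  imports Defs
begin

text \<open>
  Let \<open>s u\<close> be the norm of \<open>S e\<^sub>u\<close>. The shift has the polar decomposition \<open>S = U D\<close>, where \<open>D\<close> is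
  multiplication by \<open>s\<close> and \<open>U\<close> is the shift with weights \<open>l v / s (par v)\<close>; the adjoint \<open>U'\<close> of
  \<open>U\<close> satisfies \<open>U' U f = f\<close> on the support of \<open>s\<close>. Hence \<open>S\<^sup>* S = D\<^sup>2\<close> and \<open>S S\<^sup>* = U D\<^sup>2 U'\<close>. For a
  polynomial \<open>q\<close> one has \<open>q (U D\<^sup>2 U') = q 0 (1 - U U') + U q (D\<^sup>2) U'\<close>, so the functional calculus
  amounts to taking powers of the function \<open>s\<close>, and \<open>p\<close>-hyponormality says that
  \<open>\<Sum>\<^sub>u s\<^sub>u powr (2p) |U' f u|\<^sup>2 \<le> \<Sum>\<^sub>v s\<^sub>v powr (2p) |f v|\<^sup>2\<close> for all \<open>f\<close>. As \<open>U' f u\<close> depends only on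
  the restriction of \<open>f\<close> to \<open>Chi u\<close> and these sets are disjoint, the inequality decouples: it follows
  from the Cauchy--Schwarz inequality for each \<open>u\<close>, and it is tested on \<open>e\<^sub>v\<close> and on finite sums of
  the vectors \<open>l\<^sub>v / s\<^sub>v powr (2p) e\<^sub>v\<close>.
\<close>

section \<open>Square summable functions\<close>

text \<open>The finite inequality bounds every partial sum of absolute values by the same
  \<open>K\<close>, which yields absolute summability and the estimate of the sum at once. The
  bilinear form leaves conjugates to the caller.\<close>

lemma infsum_Cauchy_Schwarz:
  fixes a b :: "'a \<Rightarrow> complex"
  assumes "(\<lambda>v. (cmod (a v))\<^sup>2) summable_on A" and "(\<lambda>v. (cmod (b v))\<^sup>2) summable_on A"
  shows "(\<lambda>v. cmod (a v * b v)) summable_on A"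
    and "(cmod (\<Sum>\<^sub>\<infinity>v\<in>A. a v * b v))\<^sup>2 \<le>
      (\<Sum>\<^sub>\<infinity>v\<in>A. (cmod (a v))\<^sup>2) * (\<Sum>\<^sub>\<infinity>v\<in>A. (cmod (b v))\<^sup>2)"
proof -
  define K where "K = sqrt (\<Sum>\<^sub>\<infinity>v\<in>A. (cmod (a v))\<^sup>2) * sqrt (\<Sum>\<^sub>\<infinity>v\<in>A. (cmod (b v))\<^sup>2)"
  have fin: "(\<Sum>v\<in>F. cmod (a v * b v)) \<le> K" if "finite F" "F \<subseteq> A" for F
  proof -
    have "(\<Sum>v\<in>F. cmod (a v * b v)) \<le> L2_set (\<lambda>v. cmod (a v)) F * L2_set (\<lambda>v. cmod (b v)) F"
      using L2_set_mult_ineq[of "\<lambda>v. cmod (a v)" "\<lambda>v. cmod (b v)" F] by (simp add: norm_mult)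
    also have "\<dots> \<le> K"
      unfolding K_def L2_set_def
      by (intro mult_mono real_sqrt_le_mono finite_sum_le_infsum assms that
            real_sqrt_ge_zero sum_nonneg infsum_nonneg) auto
    finally show ?thesis .
  qed
  show abs: "(\<lambda>v. cmod (a v * b v)) summable_on A"
    by (rule nonneg_bdd_above_summable_on) (auto intro!: bdd_aboveI2[of _ _ K] fin)
  have "cmod (\<Sum>\<^sub>\<infinity>v\<in>A. a v * b v) \<le> (\<Sum>\<^sub>\<infinity>v\<in>A. cmod (a v * b v))"
    by (rule norm_infsum_bound[OF abs])
  also have "\<dots> \<le> K"
    by (rule infsum_le_finite_sums[OF abs fin])
  finally have "(cmod (\<Sum>\<^sub>\<infinity>v\<in>A. a v * b v))\<^sup>2 \<le> K\<^sup>2"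
    by (simp add: power_mono)
  also have "K\<^sup>2 = (\<Sum>\<^sub>\<infinity>v\<in>A. (cmod (a v))\<^sup>2) * (\<Sum>\<^sub>\<infinity>v\<in>A. (cmod (b v))\<^sup>2)"
    by (simp add: K_def power_mult_distrib infsum_nonneg)
  finally show "(cmod (\<Sum>\<^sub>\<infinity>v\<in>A. a v * b v))\<^sup>2 \<le>
      (\<Sum>\<^sub>\<infinity>v\<in>A. (cmod (a v))\<^sup>2) * (\<Sum>\<^sub>\<infinity>v\<in>A. (cmod (b v))\<^sup>2)" .
qed

lemma ell2_norm_nonneg: "0 \<le> ell2_norm V f"
  by (simp add: ell2_norm_def infsum_nonneg)

lemma ell2_norm_power2: "(ell2_norm V f)\<^sup>2 = (\<Sum>\<^sub>\<infinity>v\<in>V. (cmod (f v))\<^sup>2)"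
  by (simp add: ell2_norm_def infsum_nonneg)

lemma ell2_summable: "f \<in> ell2 V \<Longrightarrow> (\<lambda>v. (cmod (f v))\<^sup>2) summable_on V"
  by (simp add: ell2_def)

lemma ell2_outside: "f \<in> ell2 V \<Longrightarrow> v \<notin> V \<Longrightarrow> f v = 0"
  by (simp add: ell2_def)

lemma ell2_sum_le_norm:
  assumes "f \<in> ell2 V" "finite F" "F \<subseteq> V"
  shows "(\<Sum>v\<in>F. (cmod (f v))\<^sup>2) \<le> (ell2_norm V f)\<^sup>2"
  unfolding ell2_norm_power2
  by (rule finite_sum_le_infsum) (use assms in \<open>auto simp: ell2_def\<close>)

lemma ell2_L2_set_le_norm:
  assumes "f \<in> ell2 V" "finite F" "F \<subseteq> V"
  shows "L2_set (\<lambda>v. cmod (f v)) F \<le> ell2_norm V f"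
  unfolding L2_set_def using ell2_sum_le_norm[OF assms]
  by (simp add: ell2_norm_nonneg real_le_lsqrt sum_nonneg)

lemma cmod_le_ell2_norm:
  assumes "f \<in> ell2 V" "v \<in> V"
  shows "cmod (f v) \<le> ell2_norm V f"
  using ell2_L2_set_le_norm[OF assms(1), of "{v}"] assms(2) by simp

text \<open>One bound for all finite partial sums gives membership and norm bound together. The
  closure and contraction properties below are reduced to finite sums in this way.\<close>

lemma
  assumes "\<And>v. v \<notin> V \<Longrightarrow> f v = 0" and "0 \<le> C"
    and "\<And>F. finite F \<Longrightarrow> F \<subseteq> V \<Longrightarrow> (\<Sum>v\<in>F. (cmod (f v))\<^sup>2) \<le> C\<^sup>2"
  shows ell2I_sum_le: "f \<in> ell2 V"
    and ell2_norm_le_sum_le: "ell2_norm V f \<le> C"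
proof -
  have summable: "(\<lambda>v. (cmod (f v))\<^sup>2) summable_on V"
    by (rule nonneg_bdd_above_summable_on) (auto intro!: bdd_aboveI2[of _ _ "C\<^sup>2"] assms(3))
  then show "f \<in> ell2 V"
    using assms(1) by (simp add: ell2_def)
  have "(ell2_norm V f)\<^sup>2 \<le> C\<^sup>2"
    unfolding ell2_norm_power2 by (rule infsum_le_finite_sums[OF summable assms(3)])
  then show "ell2_norm V f \<le> C"
    using assms(2) by (rule power2_le_imp_le)
qed

lemma
  assumes "f \<in> ell2 V" "g \<in> ell2 V"
  shows ell2_add: "(\<lambda>v. f v + g v) \<in> ell2 V"
    and ell2_norm_add_le: "ell2_norm V (\<lambda>v. f v + g v) \<le> ell2_norm V f + ell2_norm V g"
proof -
  have *: "(\<Sum>v\<in>F. (cmod (f v + g v))\<^sup>2) \<le> (ell2_norm V f + ell2_norm V g)\<^sup>2"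
    if "finite F" "F \<subseteq> V" for F
  proof -
    have "L2_set (\<lambda>v. cmod (f v + g v)) F \<le> L2_set (\<lambda>v. cmod (f v) + cmod (g v)) F"
      by (intro L2_set_mono norm_triangle_ineq) auto
    also have "\<dots> \<le> L2_set (\<lambda>v. cmod (f v)) F + L2_set (\<lambda>v. cmod (g v)) F"
      by (rule L2_set_triangle_ineq)
    also have "\<dots> \<le> ell2_norm V f + ell2_norm V g"
      by (intro add_mono ell2_L2_set_le_norm assms that)
    finally have "(L2_set (\<lambda>v. cmod (f v + g v)) F)\<^sup>2 \<le> (ell2_norm V f + ell2_norm V g)\<^sup>2"
      by (intro power_mono) auto
    then show ?thesis
      by (simp add: L2_set_def sum_nonneg)
  qed
  show "(\<lambda>v. f v + g v) \<in> ell2 V"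
    by (rule ell2I_sum_le[OF _ _ *]) (simp_all add: assms ell2_outside[OF assms(1)] ell2_outside[OF assms(2)] ell2_norm_nonneg)
  show "ell2_norm V (\<lambda>v. f v + g v) \<le> ell2_norm V f + ell2_norm V g"
    by (rule ell2_norm_le_sum_le[OF _ _ *]) (simp_all add: assms ell2_outside[OF assms(1)] ell2_outside[OF assms(2)] ell2_norm_nonneg)
qed

lemma
  assumes "f \<in> ell2 V" "0 \<le> C" "\<And>v. v \<in> V \<Longrightarrow> cmod (d v) \<le> C"
  shows ell2_times: "(\<lambda>v. d v * f v) \<in> ell2 V"
    and ell2_norm_times_le: "ell2_norm V (\<lambda>v. d v * f v) \<le> C * ell2_norm V f"
proof -
  have *: "(\<Sum>v\<in>F. (cmod (d v * f v))\<^sup>2) \<le> (C * ell2_norm V f)\<^sup>2" if "finite F" "F \<subseteq> V" for F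
  proof -
    have "(\<Sum>v\<in>F. (cmod (d v * f v))\<^sup>2) \<le> (\<Sum>v\<in>F. C\<^sup>2 * (cmod (f v))\<^sup>2)"
      unfolding norm_mult power_mult_distrib
      by (intro sum_mono mult_right_mono power_mono assms(3)) (use that in auto)
    also have "\<dots> \<le> C\<^sup>2 * (ell2_norm V f)\<^sup>2"
      unfolding sum_distrib_left[symmetric]
      by (intro mult_left_mono ell2_sum_le_norm assms that) auto
    finally show ?thesis by (simp add: power_mult_distrib)
  qed
  show "(\<lambda>v. d v * f v) \<in> ell2 V"
    by (rule ell2I_sum_le[OF _ _ *]) (simp_all add: assms ell2_outside[OF assms(1)] ell2_norm_nonneg)
  show "ell2_norm V (\<lambda>v. d v * f v) \<le> C * ell2_norm V f"
    by (rule ell2_norm_le_sum_le[OF _ _ *]) (simp_all add: assms ell2_outside[OF assms(1)] ell2_norm_nonneg)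
qed

lemma ell2_scale: "f \<in> ell2 V \<Longrightarrow> (\<lambda>v. c * f v) \<in> ell2 V"
  by (rule ell2_times[where C = "cmod c"]) auto

lemma ell2_norm_scale: "ell2_norm V (\<lambda>v. c * f v) = cmod c * ell2_norm V f"
  by (simp add: ell2_norm_def norm_mult power_mult_distrib infsum_cmult_right' real_sqrt_mult)

lemma ell2_diff: "f \<in> ell2 V \<Longrightarrow> g \<in> ell2 V \<Longrightarrow> (\<lambda>v. f v - g v) \<in> ell2 V"
  using ell2_add[of f V "\<lambda>v. - 1 * g v"] ell2_scale[of g V "-1"] by simp

lemma ell2_zero: "(\<lambda>v. 0) \<in> ell2 V"
  by (simp add: ell2_def)

lemma ell2_norm_zero: "ell2_norm V (\<lambda>v. 0) = 0"
  by (simp add: ell2_norm_def)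

lemma ell2_finite_support:
  assumes "finite F" "F \<subseteq> V" "\<And>v. v \<notin> F \<Longrightarrow> f v = 0"
  shows "f \<in> ell2 V"
proof -
  have "(\<lambda>v. (cmod (f v))\<^sup>2) summable_on V \<longleftrightarrow> (\<lambda>v. (cmod (f v))\<^sup>2) summable_on F"
    by (rule summable_on_cong_neutral) (use assms in auto)
  then show ?thesis
    using assms by (auto simp: ell2_def)
qed

lemma basis_vec_apply: "basis_vec u v = (if v = u then 1 else 0)"
  by (simp add: basis_vec_def indicator_def)

lemma basis_vec_ell2: "u \<in> V \<Longrightarrow> basis_vec u \<in> ell2 V"
  by (rule ell2_finite_support[of "{u}"]) (auto simp: basis_vec_apply)

lemma infsum_single:
  assumes "u \<in> V" "\<And>v. v \<in> V \<Longrightarrow> v \<noteq> u \<Longrightarrow> f v = (0 :: 'b :: {comm_monoid_add, t2_space})"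
  shows "(\<Sum>\<^sub>\<infinity>v\<in>V. f v) = f u"
  using infsum_cong_neutral[of "{u}" V f f] assms by auto

lemma ell2_inner_basis_vec: "u \<in> V \<Longrightarrow> ell2_inner V (basis_vec u) g = cnj (g u)"
  unfolding ell2_inner_def by (subst infsum_single[of u]) (auto simp: basis_vec_apply)

lemma ell2_norm_basis_vec: "u \<in> V \<Longrightarrow> ell2_norm V (basis_vec u) = 1"
  unfolding ell2_norm_def by (subst infsum_single[of u]) (auto simp: basis_vec_apply)

lemma ell2_inner_summable:
  assumes "f \<in> ell2 V" "g \<in> ell2 V"
  shows "(\<lambda>v. f v * cnj (g v)) summable_on V"
  using infsum_Cauchy_Schwarz(1)[of f V "\<lambda>v. cnj (g v)"] ell2_summable[OF assms(1)]
    ell2_summable[OF assms(2)]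
  by (auto intro: abs_summable_summable)

lemma ell2_inner_diff_left:
  assumes "f \<in> ell2 V" "g \<in> ell2 V" "h \<in> ell2 V"
  shows "ell2_inner V (\<lambda>v. f v - g v) h = ell2_inner V f h - ell2_inner V g h"
  unfolding ell2_inner_def left_diff_distrib
  using infsum_add[OF ell2_inner_summable[OF assms(1,3)],
      of "\<lambda>v. - (g v * cnj (h v))"] ell2_inner_summable[OF assms(2,3)]
  by (simp add: summable_on_uminus infsum_uminus)

lemma ell2_inner_commute: "ell2_inner V f g = cnj (ell2_inner V g f)"
  unfolding ell2_inner_def by (subst infsum_cnj[symmetric]) (simp add: mult.commute)

section \<open>Bounded operators\<close>

text \<open>Unlike \<open>bounded_ops\<close>, this says nothing about values outside
  \<open>ell2 V\<close> and carries an explicit constant, so that operators given by formulas can be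
  composed and estimated without restricting them first.\<close>

definition linear_bounded_by :: "'v set \<Rightarrow> real \<Rightarrow> 'v op \<Rightarrow> bool" where
  "linear_bounded_by V C T \<longleftrightarrow> 0 \<le> C \<and> T \<in> ell2 V \<rightarrow> ell2 V \<and>
     (\<forall>f\<in>ell2 V. \<forall>g\<in>ell2 V. T (\<lambda>v. f v + g v) = (\<lambda>v. T f v + T g v)) \<and>
     (\<forall>c. \<forall>f\<in>ell2 V. T (\<lambda>v. c * f v) = (\<lambda>v. c * T f v)) \<and>
     (\<forall>f\<in>ell2 V. ell2_norm V (T f) \<le> C * ell2_norm V f)"

lemma
  assumes "linear_bounded_by V C T"
  shows linear_bounded_by_nonneg: "0 \<le> C"
    and linear_bounded_by_ell2: "f \<in> ell2 V \<Longrightarrow> T f \<in> ell2 V"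
    and linear_bounded_by_add:
      "f \<in> ell2 V \<Longrightarrow> g \<in> ell2 V \<Longrightarrow> T (\<lambda>v. f v + g v) = (\<lambda>v. T f v + T g v)"
    and linear_bounded_by_scale: "f \<in> ell2 V \<Longrightarrow> T (\<lambda>v. c * f v) = (\<lambda>v. c * T f v)"
    and linear_bounded_by_norm: "f \<in> ell2 V \<Longrightarrow> ell2_norm V (T f) \<le> C * ell2_norm V f"
  using assms unfolding linear_bounded_by_def by auto

lemma bounded_ops_iff:
  "T \<in> bounded_ops V \<longleftrightarrow> T \<in> extensional (ell2 V) \<and> (\<exists>C. linear_bounded_by V C T)"
proof
  assume T: "T \<in> bounded_ops V"
  then obtain C where C: "\<forall>f\<in>ell2 V. ell2_norm V (T f) \<le> C * ell2_norm V f"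
    by (auto simp: bounded_ops_def)
  \<comment> \<open>\<open>bounded_ops\<close> leaves the sign of \<open>C\<close> open, while
    \<open>linear_bounded_by\<close> asks for a nonnegative constant.\<close>
  have "\<forall>f\<in>ell2 V. ell2_norm V (T f) \<le> max C 0 * ell2_norm V f"
  proof
    fix f assume "f \<in> ell2 V"
    then have "ell2_norm V (T f) \<le> C * ell2_norm V f" using C by auto
    also have "\<dots> \<le> max C 0 * ell2_norm V f"
      by (intro mult_right_mono) (auto simp: ell2_norm_nonneg)
    finally show "ell2_norm V (T f) \<le> max C 0 * ell2_norm V f" .
  qed
  then have "linear_bounded_by V (max C 0) T"
    using T by (auto simp: bounded_ops_def linear_bounded_by_def)
  then show "T \<in> extensional (ell2 V) \<and> (\<exists>C. linear_bounded_by V C T)"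
    using T by (auto simp: bounded_ops_def PiE_def)
qed (auto simp: bounded_ops_def linear_bounded_by_def PiE_def)

lemma restrict_bounded_ops:
  assumes "linear_bounded_by V C T"
  shows "restrict T (ell2 V) \<in> bounded_ops V"
proof -
  have "linear_bounded_by V C (restrict T (ell2 V))"
    using assms by (auto simp: linear_bounded_by_def ell2_add ell2_scale)
  then show ?thesis by (auto simp: bounded_ops_iff)
qed

lemma linear_bounded_by_comp:
  assumes S: "linear_bounded_by V B S" and T: "linear_bounded_by V C T"
  shows "linear_bounded_by V (B * C) (\<lambda>f. S (T f))"
proof -
  have "ell2_norm V (S (T f)) \<le> B * C * ell2_norm V f" if f: "f \<in> ell2 V" for f
  proof -
    have "ell2_norm V (S (T f)) \<le> B * ell2_norm V (T f)"
      using linear_bounded_by_norm[OF S] linear_bounded_by_ell2[OF T] f by auto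
    also have "\<dots> \<le> B * (C * ell2_norm V f)"
      using linear_bounded_by_norm[OF T] linear_bounded_by_nonneg[OF S] f
      by (intro mult_left_mono) auto
    finally show ?thesis by (simp add: mult.assoc)
  qed
  moreover have "0 \<le> B * C"
    using linear_bounded_by_nonneg[OF S] linear_bounded_by_nonneg[OF T] by simp
  moreover have "S (T (\<lambda>v. f v + g v)) = (\<lambda>v. S (T f) v + S (T g) v)"
    if "f \<in> ell2 V" "g \<in> ell2 V" for f g
    using linear_bounded_by_add[OF T that] 
      linear_bounded_by_add[OF S linear_bounded_by_ell2[OF T that(1)] linear_bounded_by_ell2[OF T that(2)]]
    by simp
  moreover have "S (T (\<lambda>v. c * f v)) = (\<lambda>v. c * S (T f) v)" if "f \<in> ell2 V" for c f
    using linear_bounded_by_scale[OF T that, of c]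
      linear_bounded_by_scale[OF S linear_bounded_by_ell2[OF T that], of c] by simp
  moreover have "S (T f) \<in> ell2 V" if "f \<in> ell2 V" for f
    by (rule linear_bounded_by_ell2[OF S linear_bounded_by_ell2[OF T that]])
  ultimately show ?thesis
    by (simp add: linear_bounded_by_def)
qed

lemma linear_bounded_by_plus:
  assumes S: "linear_bounded_by V B S" and T: "linear_bounded_by V C T"
  shows "linear_bounded_by V (B + C) (\<lambda>f v. S f v + T f v)"
proof -
  have "ell2_norm V (\<lambda>v. S f v + T f v) \<le> (B + C) * ell2_norm V f" if f: "f \<in> ell2 V" for f
    using ell2_norm_add_le[of "S f" V "T f"] linear_bounded_by_ell2[OF S f]
      linear_bounded_by_ell2[OF T f] linear_bounded_by_norm[OF S f] linear_bounded_by_norm[OF T f]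
    by (simp add: distrib_right)
  moreover have "(\<lambda>v. S f v + T f v) \<in> ell2 V" if "f \<in> ell2 V" for f
    by (rule ell2_add[OF linear_bounded_by_ell2[OF S that] linear_bounded_by_ell2[OF T that]])
  ultimately show ?thesis
    unfolding linear_bounded_by_def
    by (simp add: linear_bounded_by_nonneg[OF S] linear_bounded_by_nonneg[OF T] Pi_iff
        linear_bounded_by_add[OF S] linear_bounded_by_add[OF T]
        linear_bounded_by_scale[OF S] linear_bounded_by_scale[OF T] distrib_left add_ac)
qed

lemma linear_bounded_by_scaled:
  assumes T: "linear_bounded_by V C T"
  shows "linear_bounded_by V (cmod a * C) (\<lambda>f v. a * T f v)"
proof -
  have "cmod a * ell2_norm V (T f) \<le> cmod a * C * ell2_norm V f" if f: "f \<in> ell2 V" for f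
    using linear_bounded_by_norm[OF T f] by (simp add: mult.assoc mult_left_mono)
  then show ?thesis
    unfolding linear_bounded_by_def
    by (simp add: linear_bounded_by_nonneg[OF T] Pi_iff linear_bounded_by_ell2[OF T] ell2_scale
        linear_bounded_by_add[OF T] linear_bounded_by_scale[OF T] ell2_norm_scale
        distrib_left mult.left_commute)
qed

lemma linear_bounded_by_minus:
  assumes "linear_bounded_by V B S" and "linear_bounded_by V C T"
  shows "linear_bounded_by V (B + C) (\<lambda>f v. S f v - T f v)"
  using linear_bounded_by_plus[OF assms(1) linear_bounded_by_scaled[OF assms(2), of "-1"]] by simp

lemma linear_bounded_by_id: "linear_bounded_by V 1 (\<lambda>f. f)"
  by (auto simp: linear_bounded_by_def)

lemma linear_bounded_by_cong:
  assumes "linear_bounded_by V C T" "\<And>f. f \<in> ell2 V \<Longrightarrow> S f = T f"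
  shows "linear_bounded_by V C S"
  using assms by (auto simp: linear_bounded_by_def ell2_add ell2_scale)

section \<open>Multiplication operators\<close>

definition diag_op :: "('v \<Rightarrow> real) \<Rightarrow> 'v op" where
  "diag_op d f = (\<lambda>v. complex_of_real (d v) * f v)"

lemma diag_op_diag_op: "diag_op a (diag_op b f) = diag_op (\<lambda>v. a v * b v) f"
  by (simp add: diag_op_def mult.assoc)

lemma linear_bounded_by_diag_op:
  assumes "0 \<le> C" "\<And>v. v \<in> V \<Longrightarrow> \<bar>d v\<bar> \<le> C"
  shows "linear_bounded_by V C (diag_op d)"
proof -
  have *: "cmod (complex_of_real (d v)) \<le> C" if "v \<in> V" for v
    using assms(2)[OF that] by simp
  then show ?thesis
    unfolding linear_bounded_by_def diag_op_def
    using ell2_times[OF _ assms(1) *] ell2_norm_times_le[OF _ assms(1) *] assms(1)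
    by (auto simp: distrib_left mult.left_commute)
qed

section \<open>The operator norm and the adjoint\<close>

lemma norm_le_on_unit_ball:
  assumes "linear_bounded_by V C T" "f \<in> {f \<in> ell2 V. ell2_norm V f \<le> 1}"
  shows "ell2_norm V (T f) \<le> C"
  using linear_bounded_by_norm[OF assms(1), of f] linear_bounded_by_nonneg[OF assms(1)]
    mult_left_le[of "ell2_norm V f" C] assms(2) by auto

lemma op_norm_le:
  assumes "linear_bounded_by V C T"
  shows "op_norm V T \<le> C"
  unfolding op_norm_def
proof (rule cSUP_least)
  show "{f \<in> ell2 V. ell2_norm V f \<le> 1} \<noteq> {}"
    by (auto intro!: exI[of _ "\<lambda>v. 0"] simp: ell2_zero ell2_norm_zero)
qed (rule norm_le_on_unit_ball[OF assms])

lemma norm_le_op_norm_on_unit_ball: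
  assumes "linear_bounded_by V C T" "f \<in> ell2 V" "ell2_norm V f \<le> 1"
  shows "ell2_norm V (T f) \<le> op_norm V T"
  unfolding op_norm_def
  by (rule cSUP_upper[OF _ bdd_aboveI2[OF norm_le_on_unit_ball[OF assms(1)]]]) (use assms in auto)

lemma ell2_norm_le_op_norm:
  assumes T: "linear_bounded_by V C T" and f: "f \<in> ell2 V"
  shows "ell2_norm V (T f) \<le> op_norm V T * ell2_norm V f"
proof (cases "ell2_norm V f = 0")
  case True
  then show ?thesis
    using linear_bounded_by_norm[OF T f] by simp
next
  case False
  define c where "c = ell2_norm V f"
  have "c > 0" using False ell2_norm_nonneg[of V f] by (simp add: c_def)
  define g where "g = (\<lambda>v. complex_of_real (1 / c) * f v)"
  have g: "g \<in> ell2 V" unfolding g_def by (rule ell2_scale[OF f])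
  have "ell2_norm V g \<le> 1"
    unfolding g_def ell2_norm_scale using \<open>c > 0\<close> by (simp add: c_def norm_divide)
  then have "ell2_norm V (T g) \<le> op_norm V T"
    by (rule norm_le_op_norm_on_unit_ball[OF T g])
  moreover have "ell2_norm V (T g) = ell2_norm V (T f) / c"
    unfolding g_def linear_bounded_by_scale[OF T f] ell2_norm_scale
    using \<open>c > 0\<close> by (simp add: norm_divide)
  ultimately show ?thesis
    using \<open>c > 0\<close> by (simp add: c_def field_simps)
qed

lemma op_norm_nonneg:
  assumes "linear_bounded_by V C T"
  shows "0 \<le> op_norm V T"
  using norm_le_op_norm_on_unit_ball[OF assms ell2_zero] ell2_norm_nonneg[of V "T (\<lambda>v. 0)"]
  by (simp add: ell2_norm_zero)

text \<open>An adjoint is unique because pairing with \<open>basis_vec v\<close> reads off its value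
  at \<open>v\<close>. Hence the definite description in \<open>adjoint_op\<close> is evaluated by
  exhibiting one candidate.\<close>

lemma adjoint_op_eqI:
  assumes "R \<in> bounded_ops V"
    and adj: "\<And>f g. f \<in> ell2 V \<Longrightarrow> g \<in> ell2 V \<Longrightarrow> ell2_inner V (T f) g = ell2_inner V f (R g)"
  shows "adjoint_op V T = R"
  unfolding adjoint_op_def
proof (rule the_equality)
  show "R \<in> bounded_ops V \<and>
     (\<forall>f\<in>ell2 V. \<forall>g\<in>ell2 V. ell2_inner V (T f) g = ell2_inner V f (R g))"
    using assms by blast
  fix Q assume Q: "Q \<in> bounded_ops V \<and>
     (\<forall>f\<in>ell2 V. \<forall>g\<in>ell2 V. ell2_inner V (T f) g = ell2_inner V f (Q g))"
  show "Q = R"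
  proof (rule extensionalityI[of _ "ell2 V"])
    fix g assume g: "g \<in> ell2 V"
    have "Q g \<in> ell2 V" "R g \<in> ell2 V"
      using Q assms(1) g by (auto simp: bounded_ops_def)
    moreover have "Q g v = R g v" if "v \<in> V" for v
    proof -
      have "ell2_inner V (basis_vec v) (Q g) = ell2_inner V (basis_vec v) (R g)"
        using Q adj[of "basis_vec v" g] g basis_vec_ell2[OF that] by simp
      then show ?thesis
        by (simp add: ell2_inner_basis_vec[OF that])
    qed
    ultimately show "Q g = R g"
      by (intro ext) (metis ell2_outside)
  qed (use Q assms in \<open>auto simp: bounded_ops_iff\<close>)
qed

section \<open>Powers of operators diagonalised by a partial isometry\<close>

text \<open>\<open>op_powr\<close> quantifies over all approximating sequences; if there were none,
  its condition would be vacuous and could not determine the operator. Weierstrass approximation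
  provides one, as \<open>t powr \<alpha>\<close> is continuous up to 0 for positive
  \<alpha>.\<close>

lemma polynomials_uniform_limit_powr:
  fixes M \<alpha> :: real
  assumes "\<alpha> > 0"
  obtains q :: "nat \<Rightarrow> real poly"
    where "uniform_limit {0..M} (\<lambda>n t. poly (q n) t) (\<lambda>t. t powr \<alpha>) sequentially"
proof -
  have cont: "continuous_on {0..M} (\<lambda>t. t powr \<alpha>)"
    by (rule continuous_on_powr') (use assms in \<open>auto intro: continuous_intros\<close>)
  have "\<exists>q. \<forall>t\<in>{0..M}. \<bar>t powr \<alpha> - poly q t\<bar> < e" if e: "e > 0" for e
  proof -
    obtain g :: "real \<Rightarrow> real" where g: "real_polynomial_function g"
      and approx: "\<And>t. t \<in> {0..M} \<Longrightarrow> \<bar>t powr \<alpha> - g t\<bar> < e"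
      using Stone_Weierstrass_real_polynomial_function[OF compact_Icc cont e] by blast
    obtain a n where "g = (\<lambda>t. \<Sum>i\<le>n. a i * t ^ i)"
      using g by (auto simp: real_polynomial_function_iff_sum)
    then have "poly (\<Sum>i\<le>n. monom (a i) i) t = g t" for t
      by (simp add: poly_sum poly_monom)
    then show ?thesis
      using approx by metis
  qed
  then have "\<exists>q. \<forall>t\<in>{0..M}. \<bar>t powr \<alpha> - poly q t\<bar> < inverse (real (Suc n))" for n
    by simp
  then obtain q where q: "\<And>n t. t \<in> {0..M} \<Longrightarrow> \<bar>t powr \<alpha> - poly (q n) t\<bar> < inverse (real (Suc n))"
    by metis
  have "uniform_limit {0..M} (\<lambda>n t. poly (q n) t) (\<lambda>t. t powr \<alpha>) sequentially"
  proof (rule uniform_limitI)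
    fix e :: real assume "e > 0"
    have "\<forall>\<^sub>F n in sequentially. inverse (real (Suc n)) < e"
      using LIMSEQ_inverse_real_of_nat \<open>e > 0\<close> by (rule order_tendstoD)
    then show "\<forall>\<^sub>F n in sequentially. \<forall>t\<in>{0..M}. dist (poly (q n) t) (t powr \<alpha>) < e"
      by (rule eventually_mono)
        (use q in \<open>force simp: dist_real_def abs_minus_commute intro: less_trans\<close>)
  qed
  then show ?thesis by (rule that)
qed

text \<open>With identities for \<open>W\<close> and \<open>W'\<close> this form will cover
  \<open>S^* S\<close>, and with the partial isometry of the shift and its adjoint it will cover
  \<open>S S^*\<close>. The restriction makes it extensional, as membership in
  \<open>bounded_ops\<close> demands.\<close>

definition sandwich :: "'v set \<Rightarrow> 'v op \<Rightarrow> 'v op \<Rightarrow> ('v \<Rightarrow> real) \<Rightarrow> 'v op" where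
  "sandwich V W W' d = (\<lambda>f\<in>ell2 V. W (diag_op d (W' f)))"

text \<open>Cancellation of \<open>W' W\<close> is asked only where \<open>d\<close> is nonzero: for
  the partial isometry of the shift, \<open>U' U\<close> annihilates the coordinates at which
  \<open>shift_norm\<close> vanishes.\<close>

locale diagonalised =
  fixes V :: "'v set" and W W' :: "'v op" and d :: "'v \<Rightarrow> real" and C :: real
  assumes W: "linear_bounded_by V 1 W" and W': "linear_bounded_by V 1 W'"
    and d_nonneg: "\<And>v. v \<in> V \<Longrightarrow> 0 \<le> d v"
    and d_le: "\<And>v. v \<in> V \<Longrightarrow> d v \<le> C"
    and C_nonneg: "0 \<le> C"
    and left_inverse: "\<And>f v. f \<in> ell2 V \<Longrightarrow> v \<in> V \<Longrightarrow> d v \<noteq> 0 \<Longrightarrow> W' (W f) v = f v"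
begin

lemma linear_bounded_by_sandwiched:
  assumes "0 \<le> B" "\<And>v. v \<in> V \<Longrightarrow> \<bar>e v\<bar> \<le> B"
  shows "linear_bounded_by V B (\<lambda>f. W (diag_op e (W' f)))"
  using linear_bounded_by_comp[OF W linear_bounded_by_comp[OF linear_bounded_by_diag_op[OF assms] W']]
  by simp

lemma sandwich_bounded_ops:
  assumes "0 \<le> B" "\<And>v. v \<in> V \<Longrightarrow> \<bar>e v\<bar> \<le> B"
  shows "sandwich V W W' e \<in> bounded_ops V"
  unfolding sandwich_def by (rule restrict_bounded_ops[OF linear_bounded_by_sandwiched[OF assms]])

lemma diag_op_ell2:
  assumes "0 \<le> B" "\<And>v. v \<in> V \<Longrightarrow> \<bar>e v\<bar> \<le> B" "f \<in> ell2 V"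
  shows "diag_op e f \<in> ell2 V"
  by (rule linear_bounded_by_ell2[OF linear_bounded_by_diag_op[OF assms(1,2)] assms(3)])

text \<open>The coordinates where \<open>W' W\<close> may differ from the identity are those with
  \<open>d v = 0\<close>, and there the multiplier \<open>e\<close> is zero.\<close>

lemma diag_op_left_inverse:
  assumes "f \<in> ell2 V" "\<And>v. v \<in> V \<Longrightarrow> d v = 0 \<Longrightarrow> e v = 0"
  shows "diag_op e (W' (W f)) = diag_op e f"
proof
  fix v
  have "W' (W f) \<in> ell2 V"
    using assms(1) by (intro linear_bounded_by_ell2[OF W'] linear_bounded_by_ell2[OF W])
  then show "diag_op e (W' (W f)) v = diag_op e f v"
    using assms left_inverse[of f v]
    by (cases "v \<in> V"; cases "d v = 0") (auto simp: diag_op_def ell2_outside)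
qed

lemma d_power_le: "v \<in> V \<Longrightarrow> \<bar>d v ^ i\<bar> \<le> C ^ i"
  using d_nonneg d_le by (simp add: power_mono)

text \<open>Inner factors \<open>W' W\<close> cancel under the multiplier \<open>d\<close>, so
  powers act on the multiplier alone. Only positive powers have this form: the zeroth is the
  identity, whereas the formula would give \<open>W W'\<close>.\<close>

lemma sandwich_funpow:
  assumes f: "f \<in> ell2 V"
  shows "(sandwich V W W' d ^^ Suc i) f = W (diag_op (\<lambda>v. d v ^ Suc i) (W' f))"
proof (induction i)
  case 0
  then show ?case using f by (simp add: sandwich_def)
next
  case (Suc i)
  define h where "h = diag_op (\<lambda>v. d v ^ Suc i) (W' f)"
  have h: "h \<in> ell2 V"
    unfolding h_def
    by (rule diag_op_ell2[OF zero_le_power[OF C_nonneg] d_power_le linear_bounded_by_ell2[OF W' f]])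
  then have "W h \<in> ell2 V"
    by (rule linear_bounded_by_ell2[OF W])
  have "(sandwich V W W' d ^^ Suc (Suc i)) f = sandwich V W W' d (W h)"
    unfolding h_def Suc[symmetric] by (simp only: funpow.simps o_apply)
  also have "\<dots> = W (diag_op d (W' (W h)))"
    using \<open>W h \<in> ell2 V\<close> by (simp add: sandwich_def)
  also have "diag_op d (W' (W h)) = diag_op d h"
    by (rule diag_op_left_inverse[OF h])
  also have "\<dots> = diag_op (\<lambda>v. d v ^ Suc (Suc i)) (W' f)"
    by (simp add: h_def diag_op_diag_op)
  finally show ?case .
qed

lemma power_sum_bounded: "\<exists>B\<ge>0. \<forall>v\<in>V. \<bar>\<Sum>i=1..n. c i * d v ^ i\<bar> \<le> B"
proof (intro exI conjI ballI)
  show "0 \<le> (\<Sum>i=1..n. \<bar>c i\<bar> * C ^ i)"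
    using C_nonneg by (intro sum_nonneg) auto
  fix v assume "v \<in> V"
  have "\<bar>\<Sum>i=1..n. c i * d v ^ i\<bar> \<le> (\<Sum>i=1..n. \<bar>c i * d v ^ i\<bar>)"
    by (rule sum_abs)
  also have "\<dots> \<le> (\<Sum>i=1..n. \<bar>c i\<bar> * C ^ i)"
    unfolding abs_mult by (intro sum_mono mult_left_mono d_power_le \<open>v \<in> V\<close>) auto
  finally show "\<bar>\<Sum>i=1..n. c i * d v ^ i\<bar> \<le> (\<Sum>i=1..n. \<bar>c i\<bar> * C ^ i)" .
qed

text \<open>The constant term multiplies the identity and not \<open>W W'\<close>, so it stays
  outside while the sum under \<open>W\<close> starts at 1. For a polynomial \<open>q\<close> this
  reads \<open>q(T) = q(0) + W (q(d) - q(0)) W'\<close>.\<close>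

lemma power_sum_sandwich:
  assumes f: "f \<in> ell2 V"
  shows "(\<lambda>v. \<Sum>i\<le>n. complex_of_real (c i) * (sandwich V W W' d ^^ i) f v) =
    (\<lambda>v. complex_of_real (c 0) * f v + W (diag_op (\<lambda>u. \<Sum>i=1..n. c i * d u ^ i) (W' f)) v)"
proof (induction n)
  case 0
  \<comment> \<open>Homogeneity with factor 0 shows that \<open>W\<close> maps the zero function to
    itself, which is the case of the empty sum.\<close>
  have "W (\<lambda>v. 0 * f v) = (\<lambda>v. 0 * W f v)"
    by (rule linear_bounded_by_scale[OF W f])
  then show ?case by (simp add: diag_op_def)
next
  case (Suc n)
  have W'f: "W' f \<in> ell2 V"
    by (rule linear_bounded_by_ell2[OF W' f])
  obtain B where B: "B \<ge> 0" "\<And>v. v \<in> V \<Longrightarrow> \<bar>\<Sum>i=1..n. c i * d v ^ i\<bar> \<le> B"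
    using power_sum_bounded by blast
  define h where "h = diag_op (\<lambda>u. \<Sum>i=1..n. c i * d u ^ i) (W' f)"
  define k where "k = diag_op (\<lambda>u. d u ^ Suc n) (W' f)"
  have h: "h \<in> ell2 V"
    unfolding h_def by (rule diag_op_ell2[OF B W'f])
  have k: "k \<in> ell2 V"
    unfolding k_def by (rule diag_op_ell2[OF zero_le_power[OF C_nonneg] d_power_le W'f])
  have "diag_op (\<lambda>u. \<Sum>i=1..Suc n. c i * d u ^ i) (W' f) = (\<lambda>v. h v + complex_of_real (c (Suc n)) * k v)"
    by (simp add: h_def k_def diag_op_def distrib_right mult.assoc)
  then have "W (diag_op (\<lambda>u. \<Sum>i=1..Suc n. c i * d u ^ i) (W' f)) =
      (\<lambda>v. W h v + complex_of_real (c (Suc n)) * W k v)"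
    by (simp only: linear_bounded_by_add[OF W h ell2_scale[OF k]] linear_bounded_by_scale[OF W k])
  moreover have "(sandwich V W W' d ^^ Suc n) f = W k"
    unfolding k_def by (rule sandwich_funpow[OF f])
  moreover have "(\<Sum>i\<le>n. complex_of_real (c i) * (sandwich V W W' d ^^ i) f v) =
      complex_of_real (c 0) * f v + W h v" for v
    using Suc.IH unfolding h_def by (rule fun_cong)
  ultimately show ?case
    by (simp only: sum.atMost_Suc add.assoc)
qed

lemma poly_eq_power_sum: "poly q t - coeff q 0 = (\<Sum>i=1..degree q. coeff q i * t ^ i)"
  for q :: "real poly"
  unfolding poly_altdef by (simp add: atMost_atLeast0 sum.atLeast_Suc_atMost)

lemma op_poly_sandwich:
  assumes "f \<in> ell2 V"
  shows "op_poly V q (sandwich V W W' d) f =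
    (\<lambda>v. complex_of_real (coeff q 0) * f v + W (diag_op (\<lambda>u. poly q (d u) - coeff q 0) (W' f)) v)"
  using assms by (simp add: op_poly_def power_sum_sandwich poly_eq_power_sum)

lemma linear_bounded_by_op_poly:
  "\<exists>B. linear_bounded_by V B (op_poly V q (sandwich V W W' d))"
proof -
  obtain B where B: "B \<ge> 0" "\<And>v. v \<in> V \<Longrightarrow> \<bar>poly q (d v) - coeff q 0\<bar> \<le> B"
    using power_sum_bounded[where n = "degree q" and c = "coeff q"] unfolding poly_eq_power_sum by blast
  show ?thesis
    using linear_bounded_by_cong[OF linear_bounded_by_plus[OF
          linear_bounded_by_scaled[OF linear_bounded_by_id] linear_bounded_by_sandwiched[OF B]]
        op_poly_sandwich]
    by blast
qed

lemma linear_bounded_by_sandwich: "linear_bounded_by V C (sandwich V W W' d)"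
  using linear_bounded_by_sandwiched[of C d] C_nonneg d_nonneg d_le
  by (auto intro: linear_bounded_by_cong simp: sandwich_def)

text \<open>The approximating polynomials are controlled only between 0 and the operator norm, so
  the values of \<open>d\<close> must lie there. If \<open>d u\<close> is nonzero, \<open>W\<close>
  sends \<open>basis_vec u\<close> to an eigenvector with eigenvalue \<open>d u\<close>.\<close>

lemma d_le_op_norm:
  assumes u: "u \<in> V"
  shows "d u \<le> op_norm V (sandwich V W W' d)"
proof (cases "d u = 0")
  case True
  then show ?thesis
    using op_norm_nonneg[OF linear_bounded_by_sandwich] by simp
next
  case False
  let ?b = "basis_vec u"
  have b: "?b \<in> ell2 V" by (rule basis_vec_ell2[OF u])
  then have Wb: "W ?b \<in> ell2 V" by (rule linear_bounded_by_ell2[OF W])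
  have "diag_op d (W' (W ?b)) = diag_op d ?b"
    by (rule diag_op_left_inverse[OF b])
  also have "\<dots> = (\<lambda>v. complex_of_real (d u) * ?b v)"
    by (auto simp: diag_op_def basis_vec_apply)
  finally have "sandwich V W W' d (W ?b) = (\<lambda>v. complex_of_real (d u) * W ?b v)"
    using Wb by (simp add: sandwich_def linear_bounded_by_scale[OF W b])
  then have "d u * ell2_norm V (W ?b) \<le> op_norm V (sandwich V W W' d) * ell2_norm V (W ?b)"
    using ell2_norm_le_op_norm[OF linear_bounded_by_sandwich Wb] d_nonneg[OF u]
    by (simp add: ell2_norm_scale)
  \<comment> \<open>The norm of the eigenvector can be cancelled: the contraction \<open>W'\<close>
    sends it to a vector whose coordinate at \<open>u\<close> is 1.\<close>
  moreover have "1 \<le> ell2_norm V (W ?b)"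
  proof -
    have "1 = cmod (W' (W ?b) u)"
      using left_inverse[OF b u False] by (simp add: basis_vec_apply)
    also have "\<dots> \<le> ell2_norm V (W' (W ?b))"
      by (rule cmod_le_ell2_norm[OF linear_bounded_by_ell2[OF W' Wb] u])
    also have "\<dots> \<le> ell2_norm V (W ?b)"
      using linear_bounded_by_norm[OF W' Wb] by simp
    finally show ?thesis .
  qed
  ultimately show ?thesis by simp
qed

text \<open>The difference is \<open>q_n(0)\<close> times the identity plus a multiplier between
  \<open>W\<close> and \<open>W'\<close>. Uniform convergence makes both small, since 0 and all
  values of \<open>d\<close> lie in the interval.\<close>

lemma op_norm_op_poly_tendsto:
  assumes "\<alpha> > 0"
    and lim: "uniform_limit {0..op_norm V (sandwich V W W' d)} (\<lambda>n t. poly (q n) t)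
      (\<lambda>t. t powr \<alpha>) sequentially"
  shows "(\<lambda>n. op_norm V (\<lambda>f v. op_poly V (q n) (sandwich V W W' d) f v -
    sandwich V W W' (\<lambda>v. d v powr \<alpha>) f v)) \<longlonglongrightarrow> 0"
proof (rule metric_LIMSEQ_I)
  fix r :: real assume "r > 0"
  let ?T = "sandwich V W W' d"
  \<comment> \<open>The difference will have norm at most \<open>\<bar>c\<bar> + 2 * e\<close>,
    hence at most \<open>3 * e\<close>, which is below \<open>r\<close>.\<close>
  define e where "e = r / 4"
  have "e > 0" using \<open>r > 0\<close> by (simp add: e_def)
  obtain N where N: "\<And>n t. n \<ge> N \<Longrightarrow> t \<in> {0..op_norm V ?T} \<Longrightarrow> \<bar>poly (q n) t - t powr \<alpha>\<bar> < e"
    using uniform_limitD[OF lim \<open>e > 0\<close>] unfolding eventually_sequentially dist_real_def by metis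
  show "\<exists>N. \<forall>n\<ge>N. dist (op_norm V (\<lambda>f v. op_poly V (q n) ?T f v -
    sandwich V W W' (\<lambda>v. d v powr \<alpha>) f v)) 0 < r"
  proof (intro exI allI impI)
    fix n assume "n \<ge> N"
    define c where "c = coeff (q n) 0"
    define k where "k = (\<lambda>v. poly (q n) (d v) - c - d v powr \<alpha>)"
    \<comment> \<open>At \<open>t = 0\<close> the limit is \<open>0 powr \<alpha> = 0\<close>, so
      the constant coefficient itself is small.\<close>
    have c: "\<bar>c\<bar> \<le> e"
      using N[OF \<open>n \<ge> N\<close>, of 0] op_norm_nonneg[OF linear_bounded_by_sandwich]
      by (simp add: c_def poly_0_coeff_0)
    have k: "\<bar>k v\<bar> \<le> 2 * e" if "v \<in> V" for v
      using N[OF \<open>n \<ge> N\<close>, of "d v"] d_nonneg[OF that] d_le_op_norm[OF that] c by (simp add: k_def)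
    have eq: "(\<lambda>v. op_poly V (q n) ?T f v - sandwich V W W' (\<lambda>v. d v powr \<alpha>) f v) =
        (\<lambda>v. complex_of_real c * f v + W (diag_op k (W' f)) v)" if f: "f \<in> ell2 V" for f
    proof -
      have W'f: "W' f \<in> ell2 V"
        by (rule linear_bounded_by_ell2[OF W' f])
      define h where "h = diag_op (\<lambda>v. d v powr \<alpha>) (W' f)"
      have h: "h \<in> ell2 V"
        unfolding h_def
        by (rule diag_op_ell2[of "C powr \<alpha>"])
          (use d_nonneg d_le \<open>\<alpha> > 0\<close> W'f in \<open>auto intro: powr_mono2\<close>)
      have "diag_op k (W' f) \<in> ell2 V"
        by (rule diag_op_ell2[of "2 * e"]) (use k \<open>e > 0\<close> W'f in auto)
      then have "W (\<lambda>v. diag_op k (W' f) v + h v) = (\<lambda>v. W (diag_op k (W' f)) v + W h v)"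
        by (rule linear_bounded_by_add[OF W _ h])
      moreover have "(\<lambda>v. diag_op k (W' f) v + h v) = diag_op (\<lambda>u. poly (q n) (d u) - c) (W' f)"
        by (simp add: diag_op_def k_def h_def algebra_simps)
      ultimately show ?thesis
        using f by (simp add: op_poly_sandwich c_def) (simp add: sandwich_def h_def)
    qed
    have bounded: "linear_bounded_by V (cmod (complex_of_real c) * 1 + 2 * e)
        (\<lambda>f v. op_poly V (q n) ?T f v - sandwich V W W' (\<lambda>v. d v powr \<alpha>) f v)"
      by (rule linear_bounded_by_cong[OF linear_bounded_by_plus[OF
              linear_bounded_by_scaled[OF linear_bounded_by_id] linear_bounded_by_sandwiched] eq])
        (use k \<open>e > 0\<close> in auto)
    show "dist (op_norm V (\<lambda>f v. op_poly V (q n) ?T f v -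
        sandwich V W W' (\<lambda>v. d v powr \<alpha>) f v)) 0 < r"
      using op_norm_le[OF bounded] op_norm_nonneg[OF bounded] c \<open>e > 0\<close>
      by (simp add: e_def)
  qed
qed

text \<open>The candidate has the required limit property by the previous lemma. Any other such
  \<open>Q\<close> is compared with it along one common sequence of polynomials, and the triangle
  inequality at each vertex forces equality.\<close>

lemma op_powr_sandwich:
  assumes "\<alpha> > 0"
  shows "op_powr V (sandwich V W W' d) \<alpha> = sandwich V W W' (\<lambda>v. d v powr \<alpha>)"
  unfolding op_powr_def
proof (rule the_equality)
  let ?T = "sandwich V W W' d"
  let ?R = "sandwich V W W' (\<lambda>v. d v powr \<alpha>)"
  let ?P = "\<lambda>R. \<forall>q :: nat \<Rightarrow> real poly.
        uniform_limit {0..op_norm V ?T} (\<lambda>n t. poly (q n) t) (\<lambda>t. t powr \<alpha>) sequentially \<longrightarrow>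
        (\<lambda>n. op_norm V (\<lambda>f v. op_poly V (q n) ?T f v - R f v)) \<longlonglongrightarrow> 0"
  have R: "?R \<in> bounded_ops V"
    by (rule sandwich_bounded_ops[of "C powr \<alpha>"])
      (use d_nonneg d_le assms in \<open>auto intro: powr_mono2\<close>)
  have PR: "?P ?R"
    using op_norm_op_poly_tendsto[OF assms] by blast
  show "?R \<in> bounded_ops V \<and> ?P ?R"
    using R PR by blast
  fix Q assume Q: "Q \<in> bounded_ops V \<and> ?P Q"
  obtain q where lim: "uniform_limit {0..op_norm V ?T} (\<lambda>n t. poly (q n) t) (\<lambda>t. t powr \<alpha>) sequentially"
    using polynomials_uniform_limit_powr[OF assms] by blast
  obtain B1 B2 where B1: "linear_bounded_by V B1 Q" and B2: "linear_bounded_by V B2 ?R"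
    using Q R by (auto simp: bounded_ops_iff)
  show "Q = ?R"
  proof (rule extensionalityI[of _ "ell2 V"])
    fix f assume f: "f \<in> ell2 V"
    define a where "a = (\<lambda>n. op_norm V (\<lambda>f v. op_poly V (q n) ?T f v - Q f v))"
    define b where "b = (\<lambda>n. op_norm V (\<lambda>f v. op_poly V (q n) ?T f v - ?R f v))"
    have Qf: "Q f \<in> ell2 V" and Rf: "?R f \<in> ell2 V"
      using linear_bounded_by_ell2[OF B1 f] linear_bounded_by_ell2[OF B2 f] by auto
    have le: "cmod (Q f v - ?R f v) \<le> (a n + b n) * ell2_norm V f" if "v \<in> V" for n v
    proof -
      obtain B where B: "linear_bounded_by V B (op_poly V (q n) ?T)"
        using linear_bounded_by_op_poly by blast
      let ?p = "op_poly V (q n) ?T f"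
      have p: "?p \<in> ell2 V" by (rule linear_bounded_by_ell2[OF B f])
      have "cmod (Q f v - ?R f v) \<le> cmod (?p v - Q f v) + cmod (?p v - ?R f v)"
        using norm_triangle_ineq4[of "?p v - ?R f v" "?p v - Q f v"] by simp
      also have "\<dots> \<le> ell2_norm V (\<lambda>v. ?p v - Q f v) + ell2_norm V (\<lambda>v. ?p v - ?R f v)"
        using cmod_le_ell2_norm[OF ell2_diff[OF p Qf] that]
          cmod_le_ell2_norm[OF ell2_diff[OF p Rf] that] by simp
      also have "\<dots> \<le> a n * ell2_norm V f + b n * ell2_norm V f"
        unfolding a_def b_def
        using ell2_norm_le_op_norm[OF linear_bounded_by_minus[OF B B1] f]
          ell2_norm_le_op_norm[OF linear_bounded_by_minus[OF B B2] f] by simp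
      finally show ?thesis by (simp add: distrib_right)
    qed
    have "a \<longlonglongrightarrow> 0" "b \<longlonglongrightarrow> 0"
      using Q PR lim by (auto simp: a_def b_def)
    then have "(\<lambda>n. (a n + b n) * ell2_norm V f) \<longlonglongrightarrow> (0 + 0) * ell2_norm V f"
      by (intro tendsto_intros)
    then have "cmod (Q f v - ?R f v) \<le> 0" if "v \<in> V" for v
      using LIMSEQ_le_const[of "\<lambda>n. (a n + b n) * ell2_norm V f" 0] le[OF that] by (metis add.right_neutral mult_zero_left)
    then show "Q f = ?R f"
      using ell2_outside[OF Qf] ell2_outside[OF Rf] by (intro ext) (metis eq_iff_diff_eq_0 norm_le_zero_iff)
  qed (use Q R in \<open>auto simp: bounded_ops_iff\<close>)
qed

end

section \<open>Shifts with contractive weights\<close>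

text \<open>A sum in \<open>ennreal\<close> is the supremum of its finite partial sums, and
  multiplication by a constant commutes with that supremum. This turns the second condition of the
  theorem into real inequalities over finite sets, whether or not the series converges.\<close>

lemma ennreal_mult_infsum_le_one_iff:
  fixes g :: "'a \<Rightarrow> real"
  assumes "c \<ge> 0" "\<And>x. x \<in> A \<Longrightarrow> g x \<ge> 0"
  shows "ennreal c * (\<Sum>\<^sub>\<infinity>x\<in>A. ennreal (g x)) \<le> 1 \<longleftrightarrow>
    (\<forall>F. finite F \<longrightarrow> F \<subseteq> A \<longrightarrow> c * sum g F \<le> 1)"
proof -
  have "ennreal c * (\<Sum>x\<in>F. ennreal (g x)) \<le> 1 \<longleftrightarrow> c * sum g F \<le> 1" if "F \<subseteq> A" for F
  proof -
    have "(\<Sum>x\<in>F. ennreal (g x)) = ennreal (sum g F)"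
      using that assms(2) by (intro sum_ennreal) auto
    then show ?thesis
      by (simp add: ennreal_mult'[OF assms(1), symmetric] ennreal_le_1)
  qed
  moreover have "ennreal c * (\<Sum>\<^sub>\<infinity>x\<in>A. ennreal (g x)) =
      (SUP F\<in>{F. finite F \<and> F \<subseteq> A}. ennreal c * (\<Sum>x\<in>F. ennreal (g x)))"
    by (subst nonneg_infsum_complete) (simp_all add: SUP_mult_left_ennreal)
  ultimately show ?thesis
    by (simp add: SUP_le_iff) blast
qed

section \<open>Parents, children and sums grouped by parent\<close>

context directed_tree
begin

lemma nonroots_subset: "nonroots V E \<subseteq> V"
  by (auto simp: nonroots_def)

lemma par_edge:
  assumes "v \<in> nonroots V E"
  shows "(par E v, v) \<in> E"
proof -
  have "\<exists>!u. (u, v) \<in> E"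
    using assms by (intro unique_parent) (auto simp: nonroots_def)
  then show ?thesis
    unfolding par_def by (rule theI')
qed

lemma par_eqI:
  assumes "(u, v) \<in> E"
  shows "v \<in> nonroots V E" and "par E v = u"
proof -
  have "v \<in> V" using assms edges by auto
  then show v: "v \<in> nonroots V E"
    using assms by (auto simp: nonroots_def is_root_def)
  have "\<exists>!u. (u, v) \<in> E"
    using v by (intro unique_parent) (auto simp: nonroots_def)
  then show "par E v = u"
    using par_edge[OF v] assms by blast
qed

lemma par_in_V: "v \<in> nonroots V E \<Longrightarrow> par E v \<in> V"
  using par_edge edges by blast

lemma Chi_iff: "v \<in> Chi V E u \<longleftrightarrow> v \<in> nonroots V E \<and> par E v = u"
  using par_edge par_eqI nonroots_subset by (auto simp: Chi_def)

lemma Chi_subset: "Chi V E u \<subseteq> V"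
  by (auto simp: Chi_def)

lemma Chi_disjoint: "u \<noteq> u' \<Longrightarrow> Chi V E u \<inter> Chi V E u' = {}"
  by (auto simp: Chi_iff)

text \<open>Each nonroot \<open>v\<close> occurs in exactly one pair, \<open>(par E v, v)\<close>.
  Sums over nonroots thus become iterated sums over vertices and their children.\<close>

lemma bij_betw_Sigma_Chi: "bij_betw snd (Sigma V (Chi V E)) (nonroots V E)"
  by (rule bij_betw_imageI) (force simp: inj_on_def Chi_iff par_in_V image_iff)+

text \<open>The sets of children are disjoint, so the left side is one sum of a nonnegative function
  over a subset of \<open>V\<close>. This combines inequalities found separately at each
  vertex.\<close>

lemma sum_infsum_Chi_le:
  fixes g :: "'v \<Rightarrow> real"
  assumes g: "g summable_on V" "\<And>v. v \<in> V \<Longrightarrow> 0 \<le> g v" and F: "finite F" "F \<subseteq> V"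
  shows "(\<Sum>u\<in>F. \<Sum>\<^sub>\<infinity>v\<in>Chi V E u. g v) \<le> (\<Sum>\<^sub>\<infinity>v\<in>V. g v)"
proof -
  have "(\<Sum>u\<in>F. \<Sum>\<^sub>\<infinity>v\<in>Chi V E u. g v) = (\<Sum>\<^sub>\<infinity>v\<in>(\<Union>u\<in>F. Chi V E u). g v)"
    by (rule sum_infsum[OF F(1) summable_on_subset_banach[OF g(1) Chi_subset] Chi_disjoint])
  also have "\<dots> \<le> (\<Sum>\<^sub>\<infinity>v\<in>V. g v)"
    by (intro infsum_mono2 summable_on_subset_banach[OF g(1)] g) (use Chi_subset in auto)
  finally show ?thesis .
qed

end

definition shift_adjoint :: "'v set \<Rightarrow> ('v \<times> 'v) set \<Rightarrow> ('v \<Rightarrow> complex) \<Rightarrow> 'v op" where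
  "shift_adjoint V E w g = (\<lambda>u. if u \<in> V then \<Sum>\<^sub>\<infinity>v\<in>Chi V E u. cnj (w v) * g v else 0)"

text \<open>Bounding finite sums includes summability; a bound on the real infinite sum alone would
  also hold for a divergent one, whose value is 0 by convention.\<close>

locale contractive_weights = directed_tree +
  fixes w :: "'a \<Rightarrow> complex"
  assumes weights: "\<And>u F. u \<in> V \<Longrightarrow> finite F \<Longrightarrow> F \<subseteq> Chi V E u \<Longrightarrow> (\<Sum>v\<in>F. (cmod (w v))\<^sup>2) \<le> 1"
begin

text \<open>When a finite set of vertices is grouped by parent, the square of
  \<open>cmod (f u)\<close> occurs with total weight at most 1.\<close>

lemma linear_bounded_by_shift_map: "linear_bounded_by V 1 (shift_map V E w)"
proof -
  have *: "(\<Sum>v\<in>F. (cmod (shift_map V E w f v))\<^sup>2) \<le> (ell2_norm V f)\<^sup>2"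
    if f: "f \<in> ell2 V" and F: "finite F" "F \<subseteq> V" for f F
  proof -
    define G where "G = F \<inter> nonroots V E"
    have G: "finite G" "G \<subseteq> nonroots V E" using F by (auto simp: G_def)
    have "(\<Sum>v\<in>F. (cmod (shift_map V E w f v))\<^sup>2) = (\<Sum>v\<in>G. (cmod (w v))\<^sup>2 * (cmod (f (par E v)))\<^sup>2)"
      using F by (intro sum.mono_neutral_cong_right)
        (auto simp: G_def shift_map_def norm_mult power_mult_distrib)
    also have "\<dots> = (\<Sum>u\<in>par E ` G. \<Sum>v\<in>{v\<in>G. par E v = u}. (cmod (w v))\<^sup>2 * (cmod (f (par E v)))\<^sup>2)"
      by (rule sum.image_gen[OF G(1)])
    also have "\<dots> = (\<Sum>u\<in>par E ` G. (\<Sum>v\<in>{v\<in>G. par E v = u}. (cmod (w v))\<^sup>2) * (cmod (f u))\<^sup>2)"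
      by (simp add: sum_distrib_right)
    also have "\<dots> \<le> (\<Sum>u\<in>par E ` G. 1 * (cmod (f u))\<^sup>2)"
      using G by (intro sum_mono mult_right_mono weights) (auto simp: Chi_iff par_in_V)
    also have "\<dots> \<le> (ell2_norm V f)\<^sup>2"
      unfolding mult_1 by (rule ell2_sum_le_norm[OF f]) (use G par_in_V in auto)
    finally show ?thesis .
  qed
  have outside: "shift_map V E w f v = 0" if "v \<notin> V" for f v
    using that nonroots_subset by (auto simp: shift_map_def)
  have "shift_map V E w f \<in> ell2 V" "ell2_norm V (shift_map V E w f) \<le> ell2_norm V f"
    if "f \<in> ell2 V" for f
    using ell2I_sum_le[OF outside ell2_norm_nonneg *[OF that]]
      ell2_norm_le_sum_le[OF outside ell2_norm_nonneg *[OF that]] by auto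
  moreover have "shift_map V E w (\<lambda>v. f v + g v) =
      (\<lambda>v. shift_map V E w f v + shift_map V E w g v)" for f g
    by (auto simp: shift_map_def distrib_left)
  moreover have "shift_map V E w (\<lambda>v. c * f v) = (\<lambda>v. c * shift_map V E w f v)" for c f
    by (auto simp: shift_map_def)
  ultimately show ?thesis
    by (simp add: linear_bounded_by_def)
qed

lemma weights_summable: "u \<in> V \<Longrightarrow> (\<lambda>v. (cmod (w v))\<^sup>2) summable_on Chi V E u"
  by (rule nonneg_bdd_above_summable_on) (auto intro!: bdd_aboveI2[of _ _ 1] weights)

lemma weights_infsum: "u \<in> V \<Longrightarrow> (\<Sum>\<^sub>\<infinity>v\<in>Chi V E u. (cmod (w v))\<^sup>2) \<le> 1"
  by (rule infsum_le_finite_sums[OF weights_summable weights])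

lemma shift_adjoint_summable:
  assumes "u \<in> V" "g \<in> ell2 V"
  shows "(\<lambda>v. cnj (w v) * g v) summable_on Chi V E u"
  using infsum_Cauchy_Schwarz(1)[of "\<lambda>v. cnj (w v)" "Chi V E u" g]
    weights_summable[OF assms(1)] summable_on_subset_banach[OF ell2_summable[OF assms(2)] Chi_subset]
  by (auto intro: abs_summable_summable)

text \<open>By Cauchy--Schwarz and the bound on the weights, the value at \<open>u\<close> is
  dominated by the norm of \<open>g\<close> on the children of \<open>u\<close>; these sets are
  disjoint.\<close>

lemma linear_bounded_by_shift_adjoint: "linear_bounded_by V 1 (shift_adjoint V E w)"
proof -
  have le: "(cmod (shift_adjoint V E w g u))\<^sup>2 \<le> (\<Sum>\<^sub>\<infinity>v\<in>Chi V E u. (cmod (g v))\<^sup>2)"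
    if "u \<in> V" "g \<in> ell2 V" for u g
  proof -
    have "(cmod (shift_adjoint V E w g u))\<^sup>2 \<le>
        (\<Sum>\<^sub>\<infinity>v\<in>Chi V E u. (cmod (w v))\<^sup>2) * (\<Sum>\<^sub>\<infinity>v\<in>Chi V E u. (cmod (g v))\<^sup>2)"
      using infsum_Cauchy_Schwarz(2)[of "\<lambda>v. cnj (w v)" "Chi V E u" g] that
        weights_summable summable_on_subset_banach[OF ell2_summable[OF that(2)] Chi_subset]
      by (simp add: shift_adjoint_def)
    also have "\<dots> \<le> 1 * (\<Sum>\<^sub>\<infinity>v\<in>Chi V E u. (cmod (g v))\<^sup>2)"
      by (intro mult_right_mono weights_infsum that infsum_nonneg) auto
    finally show ?thesis by simp
  qed
  have *: "(\<Sum>u\<in>F. (cmod (shift_adjoint V E w g u))\<^sup>2) \<le> (ell2_norm V g)\<^sup>2"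
    if g: "g \<in> ell2 V" and F: "finite F" "F \<subseteq> V" for g F
  proof -
    have "(\<Sum>u\<in>F. (cmod (shift_adjoint V E w g u))\<^sup>2) \<le>
        (\<Sum>u\<in>F. \<Sum>\<^sub>\<infinity>v\<in>Chi V E u. (cmod (g v))\<^sup>2)"
      by (intro sum_mono le g) (use F in auto)
    also have "\<dots> \<le> (ell2_norm V g)\<^sup>2"
      unfolding ell2_norm_power2 by (rule sum_infsum_Chi_le[OF ell2_summable[OF g] _ F]) auto
    finally show ?thesis .
  qed
  have outside: "shift_adjoint V E w g u = 0" if "u \<notin> V" for g u
    using that by (simp add: shift_adjoint_def)
  have "shift_adjoint V E w g \<in> ell2 V" "ell2_norm V (shift_adjoint V E w g) \<le> ell2_norm V g"
    if "g \<in> ell2 V" for g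
    using ell2I_sum_le[OF outside ell2_norm_nonneg *[OF that]]
      ell2_norm_le_sum_le[OF outside ell2_norm_nonneg *[OF that]] by auto
  moreover have "shift_adjoint V E w (\<lambda>v. f v + g v) =
      (\<lambda>v. shift_adjoint V E w f v + shift_adjoint V E w g v)"
    if "f \<in> ell2 V" "g \<in> ell2 V" for f g
    using infsum_add[OF shift_adjoint_summable shift_adjoint_summable, OF _ that(1) _ that(2)]
    by (auto simp: shift_adjoint_def distrib_left)
  moreover have "shift_adjoint V E w (\<lambda>v. c * f v) = (\<lambda>v. c * shift_adjoint V E w f v)" for c f
    by (auto simp: shift_adjoint_def mult.left_commute[of _ c] infsum_cmult_right')
  ultimately show ?thesis
    by (simp add: linear_bounded_by_def)
qed

text \<open>Both sides are the sum of \<open>k v\<close> over the nonroots: the right side groups it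
  by parent, and \<open>f (par E v)\<close> is constant on each group.\<close>

lemma ell2_inner_shift_map:
  assumes f: "f \<in> ell2 V" and g: "g \<in> ell2 V"
  shows "ell2_inner V (shift_map V E w f) g = ell2_inner V f (shift_adjoint V E w g)"
proof -
  define k where "k = (\<lambda>v. w v * f (par E v) * cnj (g v))"
  \<comment> \<open>Regrouping by parent requires summability over all pairs, which is inherited
    from the inner product of two square summable functions.\<close>
  have "(\<lambda>v. shift_map V E w f v * cnj (g v)) summable_on nonroots V E"
    by (rule summable_on_subset_banach[OF ell2_inner_summable nonroots_subset])
      (rule linear_bounded_by_ell2[OF linear_bounded_by_shift_map f] g)+
  then have "k summable_on nonroots V E"
    by (rule summable_on_cong[THEN iffD1, rotated]) (simp add: k_def shift_map_def)
  then have summable: "(\<lambda>x. k (snd x)) summable_on Sigma V (Chi V E)"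
    by (simp add: summable_on_reindex_bij_betw[OF bij_betw_Sigma_Chi])
  have "ell2_inner V (shift_map V E w f) g = (\<Sum>\<^sub>\<infinity>v\<in>nonroots V E. k v)"
    unfolding ell2_inner_def k_def
    by (rule infsum_cong_neutral) (use nonroots_subset in \<open>auto simp: shift_map_def\<close>)
  also have "\<dots> = (\<Sum>\<^sub>\<infinity>x\<in>Sigma V (Chi V E). k (snd x))"
    by (rule infsum_reindex_bij_betw[OF bij_betw_Sigma_Chi, symmetric])
  also have "\<dots> = (\<Sum>\<^sub>\<infinity>u\<in>V. \<Sum>\<^sub>\<infinity>v\<in>Chi V E u. k v)"
    using infsum_Sigma_banach[OF summable] by simp
  also have "\<dots> = (\<Sum>\<^sub>\<infinity>u\<in>V. f u * cnj (shift_adjoint V E w g u))"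
  proof (rule infsum_cong)
    fix u assume "u \<in> V"
    have "(\<Sum>\<^sub>\<infinity>v\<in>Chi V E u. k v) = (\<Sum>\<^sub>\<infinity>v\<in>Chi V E u. f u * cnj (cnj (w v) * g v))"
      by (rule infsum_cong) (simp add: k_def Chi_iff mult_ac)
    also have "\<dots> = f u * cnj (shift_adjoint V E w g u)"
      using \<open>u \<in> V\<close> by (simp only: infsum_cmult_right' infsum_cnj shift_adjoint_def if_True)
    finally show "(\<Sum>\<^sub>\<infinity>v\<in>Chi V E u. k v) = f u * cnj (shift_adjoint V E w g u)" .
  qed
  finally show ?thesis by (simp add: ell2_inner_def)
qed

text \<open>All children of \<open>u\<close> carry multiples of the same value \<open>f u\<close>,
  so the composition is diagonal.\<close>

lemma shift_adjoint_shift_map: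
  assumes "u \<in> V"
  shows "shift_adjoint V E w (shift_map V E w f) u =
    complex_of_real (\<Sum>\<^sub>\<infinity>v\<in>Chi V E u. (cmod (w v))\<^sup>2) * f u"
proof -
  have "shift_adjoint V E w (shift_map V E w f) u =
      (\<Sum>\<^sub>\<infinity>v\<in>Chi V E u. complex_of_real ((cmod (w v))\<^sup>2) * f u)"
    using assms unfolding shift_adjoint_def
    by (auto intro!: infsum_cong simp: shift_map_def Chi_iff complex_norm_square mult_ac
        simp del: of_real_power)
  also have "\<dots> = complex_of_real (\<Sum>\<^sub>\<infinity>v\<in>Chi V E u. (cmod (w v))\<^sup>2) * f u"
    unfolding infsum_cmult_left'
    by (simp only: infsumI[OF has_sum_of_real[OF has_sum_infsum[OF weights_summable[OF assms]]]])
  finally show ?thesis .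
qed

end

section \<open>The polar decomposition of a bounded weighted shift\<close>

lemma diagonalised_id:
  assumes "\<And>v. v \<in> V \<Longrightarrow> 0 \<le> d v" "\<And>v. v \<in> V \<Longrightarrow> d v \<le> C" "0 \<le> C"
  shows "diagonalised V (\<lambda>f. f) (\<lambda>f. f) d C"
  by unfold_locales (use assms linear_bounded_by_id in auto)

lemma
  assumes f: "f \<in> ell2 V" and a: "\<And>v. v \<in> V \<Longrightarrow> \<bar>a v\<bar> \<le> B"
  shows summable_weighted_ell2: "(\<lambda>v. a v * (cmod (f v))\<^sup>2) summable_on V"
    and ell2_inner_diag_op_self:
      "ell2_inner V (diag_op a f) f = complex_of_real (\<Sum>\<^sub>\<infinity>v\<in>V. a v * (cmod (f v))\<^sup>2)"
proof -
  have "(\<lambda>v. norm (B * (cmod (f v))\<^sup>2)) summable_on V"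
    using ell2_summable[OF f] by (simp add: abs_mult summable_on_cmult_right)
  then have "(\<lambda>v. norm (a v * (cmod (f v))\<^sup>2)) summable_on V"
    by (rule Infinite_Sum.abs_summable_on_comparison_test)
      (use a in \<open>auto simp: abs_mult intro!: mult_right_mono intro: order_trans[OF _ abs_ge_self]\<close>)
  then show sm: "(\<lambda>v. a v * (cmod (f v))\<^sup>2) summable_on V"
    by (rule abs_summable_summable)
  have "ell2_inner V (diag_op a f) f = (\<Sum>\<^sub>\<infinity>v\<in>V. complex_of_real (a v * (cmod (f v))\<^sup>2))"
    unfolding ell2_inner_def diag_op_def
    by (rule infsum_cong) (simp add: complex_norm_square mult_ac del: of_real_power)
  also have "\<dots> = complex_of_real (\<Sum>\<^sub>\<infinity>v\<in>V. a v * (cmod (f v))\<^sup>2)"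
    by (rule infsumI[OF has_sum_of_real[OF has_sum_infsum[OF sm]]])
  finally show "ell2_inner V (diag_op a f) f = complex_of_real (\<Sum>\<^sub>\<infinity>v\<in>V. a v * (cmod (f v))\<^sup>2)" .
qed

lemma ell2_inner_diag_op: "ell2_inner V (diag_op a f) g = ell2_inner V f (diag_op a g)"
  by (simp add: ell2_inner_def diag_op_def mult_ac)

locale bounded_weighted_shift = directed_tree V E for V :: "'v set" and E +
  fixes l :: "'v \<Rightarrow> complex"
  assumes shift_domain: "shift_domain V E l = ell2 V"
    and shift_bounded: "weighted_shift V E l \<in> bounded_ops V"
begin

abbreviation s :: "'v \<Rightarrow> real" where
  "s \<equiv> shift_norm V E l"

text \<open>Division by zero gives weight 0 to the children of a vertex with \<open>s u = 0\<close>.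
  The shift with weights \<open>w\<close> is thereby a partial isometry that annihilates
  \<open>basis_vec u\<close> for such \<open>u\<close>.\<close>

definition w :: "'v \<Rightarrow> complex" where
  "w v = l v / complex_of_real (s (par E v))"

abbreviation "U \<equiv> shift_map V E w"
abbreviation "U' \<equiv> shift_adjoint V E w"

lemma s_nonneg: "0 \<le> s u"
  by (simp add: shift_norm_def ell2_norm_nonneg)

lemma
  assumes u: "u \<in> V"
  shows weights_summable_on_Chi: "(\<lambda>v. (cmod (l v))\<^sup>2) summable_on Chi V E u"
    and s_power2: "(s u)\<^sup>2 = (\<Sum>\<^sub>\<infinity>v\<in>Chi V E u. (cmod (l v))\<^sup>2)"
proof -
  let ?f = "shift_map V E l (basis_vec u)"
  have f: "?f \<in> ell2 V"
    using shift_domain basis_vec_ell2[OF u] by (auto simp: shift_domain_def)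
  have f_eq: "?f v = (if v \<in> Chi V E u then l v else 0)" for v
    by (auto simp: shift_map_def basis_vec_apply Chi_iff)
  have "(\<lambda>v. (cmod (?f v))\<^sup>2) summable_on Chi V E u"
    by (rule summable_on_subset_banach[OF ell2_summable[OF f] Chi_subset])
  then show "(\<lambda>v. (cmod (l v))\<^sup>2) summable_on Chi V E u"
    by (rule summable_on_cong[THEN iffD1, rotated]) (simp add: f_eq)
  have "(s u)\<^sup>2 = (\<Sum>\<^sub>\<infinity>v\<in>V. (cmod (?f v))\<^sup>2)"
    using basis_vec_ell2[OF u]
    by (simp add: shift_norm_def weighted_shift_def shift_domain ell2_norm_power2)
  also have "\<dots> = (\<Sum>\<^sub>\<infinity>v\<in>Chi V E u. (cmod (l v))\<^sup>2)"
    by (rule infsum_cong_neutral) (use Chi_subset in \<open>auto simp: f_eq\<close>)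
  finally show "(s u)\<^sup>2 = (\<Sum>\<^sub>\<infinity>v\<in>Chi V E u. (cmod (l v))\<^sup>2)" .
qed

lemma weight_sum_le:
  assumes "u \<in> V" "finite F" "F \<subseteq> Chi V E u"
  shows "(\<Sum>v\<in>F. (cmod (l v))\<^sup>2) \<le> (s u)\<^sup>2"
  unfolding s_power2[OF assms(1)]
  by (rule finite_sum_le_infsum[OF weights_summable_on_Chi[OF assms(1)] assms(2,3)]) auto

lemma weight_eq_0:
  assumes "v \<in> Chi V E u" "s u = 0"
  shows "l v = 0"
  using weight_sum_le[of u "{v}"] assms edges by (auto simp: Chi_def)

sublocale contractive_weights V E w
proof
  fix u F assume u: "u \<in> V" and F: "finite F" "F \<subseteq> Chi V E u"
  have "(\<Sum>v\<in>F. (cmod (w v))\<^sup>2) = (\<Sum>v\<in>F. (cmod (l v))\<^sup>2) / (s u)\<^sup>2"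
    unfolding sum_divide_distrib
    by (rule sum.cong) (use F in \<open>auto simp: w_def Chi_iff norm_divide power_divide\<close>)
  \<comment> \<open>For \<open>s u = 0\<close> the quotient is 0, so the bound holds there as
    well.\<close>
  also have "\<dots> \<le> 1"
    using weight_sum_le[OF u F] by (auto simp: divide_le_eq_1)
  finally show "(\<Sum>v\<in>F. (cmod (w v))\<^sup>2) \<le> 1" .
qed

text \<open>Where \<open>s u\<close> is nonzero, the squared moduli of the normalised weights on the
  children add up to exactly 1.\<close>

lemma left_inverse:
  assumes "u \<in> V" "s u \<noteq> 0"
  shows "U' (U f) u = f u"
proof -
  have "(\<Sum>\<^sub>\<infinity>v\<in>Chi V E u. (cmod (w v))\<^sup>2) = (\<Sum>\<^sub>\<infinity>v\<in>Chi V E u. (cmod (l v))\<^sup>2 * inverse ((s u)\<^sup>2))"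
    by (rule infsum_cong) (auto simp: w_def Chi_iff norm_divide power_divide field_simps)
  also have "\<dots> = 1"
    unfolding infsum_cmult_left' s_power2[OF assms(1), symmetric] using assms(2) by simp
  finally show ?thesis
    by (simp add: shift_adjoint_shift_map[OF assms(1)])
qed

lemma s_bounded: "\<exists>C\<ge>0. \<forall>v\<in>V. s v \<le> C"
proof -
  obtain C where C: "linear_bounded_by V C (weighted_shift V E l)"
    using shift_bounded by (auto simp: bounded_ops_iff)
  have "s v \<le> C" if "v \<in> V" for v
    using linear_bounded_by_norm[OF C basis_vec_ell2[OF that]]
    by (simp add: shift_norm_def ell2_norm_basis_vec that)
  then show ?thesis
    using linear_bounded_by_nonneg[OF C] by blast
qed

definition C where "C = (SOME C. C \<ge> 0 \<and> (\<forall>v\<in>V. s v \<le> C))"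

lemma C_nonneg: "0 \<le> C" and s_le: "v \<in> V \<Longrightarrow> s v \<le> C"
  using someI_ex[of "\<lambda>C. C \<ge> 0 \<and> (\<forall>v\<in>V. s v \<le> C)"] s_bounded unfolding C_def by auto

lemma abs_s_le: "v \<in> V \<Longrightarrow> \<bar>s v\<bar> \<le> C"
  using s_nonneg s_le by simp

lemma diag_op_s_ell2: "f \<in> ell2 V \<Longrightarrow> diag_op s f \<in> ell2 V"
  by (rule linear_bounded_by_ell2[OF linear_bounded_by_diag_op[OF C_nonneg abs_s_le]])

text \<open>The factor \<open>s (par E v)\<close> cancels against the denominator of
  \<open>w v\<close>; where it is zero, \<open>l v\<close> vanishes too.\<close>

lemma weighted_shift_eq: "weighted_shift V E l = (\<lambda>f\<in>ell2 V. U (diag_op s f))"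
proof -
  have "shift_map V E l f = U (diag_op s f)" for f
    using weight_eq_0 by (fastforce simp: shift_map_def diag_op_def w_def Chi_iff)
  then show ?thesis
    by (auto simp: weighted_shift_def shift_domain intro!: restrict_ext)
qed

lemma adjoint_weighted_shift: "adjoint_op V (weighted_shift V E l) = (\<lambda>f\<in>ell2 V. diag_op s (U' f))"
proof (rule adjoint_op_eqI)
  show "(\<lambda>f\<in>ell2 V. diag_op s (U' f)) \<in> bounded_ops V"
    by (rule restrict_bounded_ops[OF linear_bounded_by_comp[OF
            linear_bounded_by_diag_op[OF C_nonneg abs_s_le] linear_bounded_by_shift_adjoint]])
  show "ell2_inner V (weighted_shift V E l f) g = ell2_inner V f ((\<lambda>f\<in>ell2 V. diag_op s (U' f)) g)"
    if "f \<in> ell2 V" "g \<in> ell2 V" for f g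
    using that
    by (simp add: weighted_shift_eq ell2_inner_shift_map diag_op_s_ell2 ell2_inner_diag_op)
qed

text \<open>\<open>op_abs\<close> of the adjoint is built from the adjoint of the adjoint.
  Conjugating the adjoint identity shows the latter to be the shift.\<close>

lemma adjoint_adjoint_weighted_shift:
  "adjoint_op V (adjoint_op V (weighted_shift V E l)) = weighted_shift V E l"
proof (rule adjoint_op_eqI[OF shift_bounded])
  fix f g assume f: "f \<in> ell2 V" and g: "g \<in> ell2 V"
  have "ell2_inner V (weighted_shift V E l g) f = ell2_inner V g (adjoint_op V (weighted_shift V E l) f)"
    using f g unfolding adjoint_weighted_shift
    by (simp add: weighted_shift_eq ell2_inner_shift_map diag_op_s_ell2 ell2_inner_diag_op)
  then show "ell2_inner V (adjoint_op V (weighted_shift V E l) f) g =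
      ell2_inner V f (weighted_shift V E l g)"
    using ell2_inner_commute by metis
qed

lemma diagonalised_isometry:
  assumes "\<And>v. v \<in> V \<Longrightarrow> 0 \<le> d v" "\<And>v. v \<in> V \<Longrightarrow> d v \<le> B" "0 \<le> B"
    and "\<And>v. v \<in> V \<Longrightarrow> s v = 0 \<Longrightarrow> d v = 0"
  shows "diagonalised V U U' d B"
proof
  show "U' (U f) v = f v" if "v \<in> V" "d v \<noteq> 0" for f v
    using that assms(4) by (intro left_inverse) auto
qed (use assms linear_bounded_by_shift_map linear_bounded_by_shift_adjoint in auto)

text \<open>The inner \<open>U' U\<close> stands under the multiplier \<open>s\<close>, which
  vanishes wherever \<open>U' U\<close> fails to be the identity, so two factors \<open>s\<close>
  remain.\<close>

lemma compose_adjoint_weighted_shift: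
  "compose (ell2 V) (adjoint_op V (weighted_shift V E l)) (weighted_shift V E l) =
    sandwich V (\<lambda>f. f) (\<lambda>f. f) (\<lambda>v. (s v)\<^sup>2)"
  unfolding compose_def sandwich_def adjoint_weighted_shift
  unfolding weighted_shift_eq
proof (rule restrict_ext)
  fix f assume f: "f \<in> ell2 V"
  interpret diagonalised V U U' s C
    by (rule diagonalised_isometry) (use s_nonneg s_le C_nonneg in auto)
  have "U (diag_op s f) \<in> ell2 V"
    by (rule linear_bounded_by_ell2[OF W diag_op_s_ell2[OF f]])
  then show "(\<lambda>f\<in>ell2 V. diag_op s (U' f)) ((\<lambda>f\<in>ell2 V. U (diag_op s f)) f) =
      diag_op (\<lambda>v. (s v)\<^sup>2) f"
    using f diag_op_left_inverse[OF diag_op_s_ell2[OF f], of s]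
    by (simp add: diag_op_diag_op power2_eq_square)
qed

lemma compose_weighted_shift_adjoint:
  "compose (ell2 V) (weighted_shift V E l) (adjoint_op V (weighted_shift V E l)) =
    sandwich V U U' (\<lambda>v. (s v)\<^sup>2)"
  unfolding compose_def sandwich_def adjoint_weighted_shift
  unfolding weighted_shift_eq
proof (rule restrict_ext)
  fix f assume f: "f \<in> ell2 V"
  then have "diag_op s (U' f) \<in> ell2 V"
    by (intro diag_op_s_ell2 linear_bounded_by_ell2[OF linear_bounded_by_shift_adjoint])
  then show "(\<lambda>f\<in>ell2 V. U (diag_op s f)) ((\<lambda>f\<in>ell2 V. diag_op s (U' f)) f) =
      U (diag_op (\<lambda>v. (s v)\<^sup>2) (U' f))"
    using f by (simp add: diag_op_diag_op power2_eq_square)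
qed

lemma s_power2_powr_half: "(\<lambda>v. (s v)\<^sup>2 powr (1 / 2)) = s"
  by (simp add: powr_half_sqrt s_nonneg)

lemma s_power2_le: "v \<in> V \<Longrightarrow> (s v)\<^sup>2 \<le> C\<^sup>2"
  by (simp add: power_mono s_nonneg s_le)

text \<open>The functional calculus is applied twice to each product: exponent \<open>1 / 2\<close>
  turns the square of \<open>s\<close> into \<open>s\<close>, then exponent \<open>p\<close> acts on
  \<open>s\<close>. Hence the four instances of the locale.\<close>

lemma op_powr_op_abs:
  assumes "p > 0"
  shows "op_powr V (op_abs V (weighted_shift V E l)) p =
      sandwich V (\<lambda>f. f) (\<lambda>f. f) (\<lambda>v. s v powr p)"
    and "op_powr V (op_abs V (adjoint_op V (weighted_shift V E l))) p =
      sandwich V U U' (\<lambda>v. s v powr p)"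
proof -
  interpret A2: diagonalised V "\<lambda>f. f" "\<lambda>f. f" "\<lambda>v. (s v)\<^sup>2" "C\<^sup>2"
    by (rule diagonalised_id) (use s_power2_le in auto)
  interpret A: diagonalised V "\<lambda>f. f" "\<lambda>f. f" s C
    by (rule diagonalised_id) (use s_nonneg s_le C_nonneg in auto)
  interpret B2: diagonalised V U U' "\<lambda>v. (s v)\<^sup>2" "C\<^sup>2"
    by (rule diagonalised_isometry) (use s_power2_le in auto)
  interpret B: diagonalised V U U' s C
    by (rule diagonalised_isometry) (use s_nonneg s_le C_nonneg in auto)
  show "op_powr V (op_abs V (weighted_shift V E l)) p =
      sandwich V (\<lambda>f. f) (\<lambda>f. f) (\<lambda>v. s v powr p)"
    using A2.op_powr_sandwich[of "1 / 2"] A.op_powr_sandwich[OF assms]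
    by (simp only: op_abs_def compose_adjoint_weighted_shift s_power2_powr_half)
  show "op_powr V (op_abs V (adjoint_op V (weighted_shift V E l))) p =
      sandwich V U U' (\<lambda>v. s v powr p)"
    using B2.op_powr_sandwich[of "1 / 2"] B.op_powr_sandwich[OF assms]
    by (simp only: op_abs_def adjoint_adjoint_weighted_shift compose_weighted_shift_adjoint
        s_power2_powr_half)
qed

section \<open>Characterisation of \<open>p\<close>-hyponormality\<close>

lemma abs_s_powr_le: "v \<in> V \<Longrightarrow> q > 0 \<Longrightarrow> \<bar>s v powr q\<bar> \<le> C powr q"
  using s_nonneg s_le by (simp add: powr_mono2)

text \<open>Moving \<open>U\<close> across the inner product as \<open>U'\<close> makes both
  quadratic forms weighted sums of squares. They are real, so \<open>op_le\<close> compares two real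
  numbers.\<close>

lemma p_hyponormal_iff_quadratic_form:
  assumes "p > 0"
  shows "p_hyponormal V p (weighted_shift V E l) \<longleftrightarrow>
    (\<forall>f\<in>ell2 V. (\<Sum>\<^sub>\<infinity>u\<in>V. s u powr (2 * p) * (cmod (U' f u))\<^sup>2) \<le>
      (\<Sum>\<^sub>\<infinity>v\<in>V. s v powr (2 * p) * (cmod (f v))\<^sup>2))"
proof -
  define a where "a = (\<lambda>v. s v powr (2 * p))"
  have a: "\<bar>a v\<bar> \<le> C powr (2 * p)" if "v \<in> V" for v
    using abs_s_powr_le[OF that, of "2 * p"] assms by (simp add: a_def)
  have "ell2_inner V (\<lambda>v. diag_op a f v - U (diag_op a (U' f)) v) f =
      complex_of_real ((\<Sum>\<^sub>\<infinity>v\<in>V. a v * (cmod (f v))\<^sup>2) - (\<Sum>\<^sub>\<infinity>u\<in>V. a u * (cmod (U' f u))\<^sup>2))"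
    if f: "f \<in> ell2 V" for f
  proof -
    have U'f: "U' f \<in> ell2 V"
      by (rule linear_bounded_by_ell2[OF linear_bounded_by_shift_adjoint f])
    have diag: "diag_op a g \<in> ell2 V" if "g \<in> ell2 V" for g
      by (rule linear_bounded_by_ell2[OF linear_bounded_by_diag_op[OF _ a] that]) simp
    have "ell2_inner V (\<lambda>v. diag_op a f v - U (diag_op a (U' f)) v) f =
        ell2_inner V (diag_op a f) f - ell2_inner V (U (diag_op a (U' f))) f"
      by (rule ell2_inner_diff_left[OF diag[OF f]
            linear_bounded_by_ell2[OF linear_bounded_by_shift_map diag[OF U'f]] f])
    also have "ell2_inner V (U (diag_op a (U' f))) f = ell2_inner V (diag_op a (U' f)) (U' f)"
      by (rule ell2_inner_shift_map[OF diag[OF U'f] f])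
    finally show ?thesis
      by (simp add: ell2_inner_diag_op_self[OF f a] ell2_inner_diag_op_self[OF U'f a])
  qed
  then show ?thesis
    using assms
    by (simp add: p_hyponormal_def op_le_def op_powr_op_abs sandwich_def a_def
        del: of_real_diff)
qed

lemma shift_adjoint_eq:
  assumes "u \<in> V"
  shows "U' f u = (\<Sum>\<^sub>\<infinity>v\<in>Chi V E u. cnj (l v) / complex_of_real (s u) * f v)"
  using assms by (auto intro!: infsum_cong simp: shift_adjoint_def w_def Chi_iff)

end

section \<open>Necessity and sufficiency of the two conditions\<close>

context bounded_weighted_shift
begin

lemma V_plus_iff: "u \<in> V_plus V E l \<longleftrightarrow> u \<in> V \<and> s u \<noteq> 0"
  using s_nonneg[of u] by (auto simp: V_plus_def)

lemma s_powr_power2: "(s v powr q)\<^sup>2 = s v powr (2 * q)"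
  by (simp add: power2_eq_square powr_add[symmetric])

lemma s_powr_diff: "s u \<noteq> 0 \<Longrightarrow> s u powr (2 * (p - 1)) = s u powr (2 * p) / (s u)\<^sup>2"
  using s_nonneg[of u] by (simp add: right_diff_distrib powr_diff)

text \<open>For the test function \<open>basis_vec v\<close> the right side is
  \<open>s v powr (2 * p) = 0\<close>, while the left side contains the term at \<open>u\<close>, a
  positive multiple of the square of \<open>cmod (l v)\<close> when \<open>s u\<close> is
  nonzero.\<close>

lemma weight_eq_0_of_p_hyponormal:
  assumes "p > 0" "p_hyponormal V p (weighted_shift V E l)" "v \<in> Chi V E u" "s v = 0"
  shows "l v = 0"
proof (cases "s u = 0")
  case True
  then show ?thesis using weight_eq_0 assms(3) by blast
next
  case False
  have u: "u \<in> V" and v: "v \<in> V" using assms(3) edges by (auto simp: Chi_def)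
  let ?b = "basis_vec v"
  have b: "?b \<in> ell2 V" by (rule basis_vec_ell2[OF v])
  have U'b: "U' ?b \<in> ell2 V"
    by (rule linear_bounded_by_ell2[OF linear_bounded_by_shift_adjoint b])
  have "U' ?b u = cnj (l v) / complex_of_real (s u)"
    unfolding shift_adjoint_eq[OF u]
    by (subst infsum_single[OF assms(3)]) (auto simp: basis_vec_apply)
  then have "s u powr (2 * p) * ((cmod (l v))\<^sup>2 / (s u)\<^sup>2) = (\<Sum>x\<in>{u}. s x powr (2 * p) * (cmod (U' ?b x))\<^sup>2)"
    by (simp add: norm_divide power_divide)
  also have "\<dots> \<le> (\<Sum>\<^sub>\<infinity>x\<in>V. s x powr (2 * p) * (cmod (U' ?b x))\<^sup>2)"
    by (rule finite_sum_le_infsum[OF summable_weighted_ell2[OF U'b abs_s_powr_le]])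
      (use u assms(1) in auto)
  also have "\<dots> \<le> (\<Sum>\<^sub>\<infinity>x\<in>V. s x powr (2 * p) * (cmod (?b x))\<^sup>2)"
    using assms(2) b unfolding p_hyponormal_iff_quadratic_form[OF assms(1)] by blast
  also have "\<dots> = 0"
    by (rule infsum_0) (auto simp: basis_vec_apply assms(4))
  finally have "s u powr (2 * p) * ((cmod (l v))\<^sup>2 / (s u)\<^sup>2) \<le> 0" .
  then show ?thesis
    using False s_nonneg[of u] by (simp add: mult_le_0_iff divide_le_0_iff)
qed

text \<open>The test function is the equality case of Cauchy--Schwarz on \<open>F\<close>. The
  quadratic inequality then reads \<open>s u powr (2 * (p - 1)) * A * A \<le> A\<close>.\<close>

lemma sum_le_one_of_p_hyponormal:
  assumes "p > 0" "p_hyponormal V p (weighted_shift V E l)" "u \<in> V_plus V E l"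
    and F: "finite F" "F \<subseteq> Chi_plus V E l u"
  shows "s u powr (2 * (p - 1)) * (\<Sum>v\<in>F. (cmod (l v))\<^sup>2 / s v powr (2 * p)) \<le> 1"
proof -
  have u: "u \<in> V" "s u \<noteq> 0" using assms(3) by (auto simp: V_plus_iff)
  have FChi: "F \<subseteq> Chi V E u" and FV: "F \<subseteq> V" and sF: "\<And>v. v \<in> F \<Longrightarrow> s v \<noteq> 0"
    using F(2) by (auto simp: Chi_plus_def Chi_def V_plus_iff)
  \<comment> \<open>With this choice both \<open>cnj (l v) * f v\<close> and
    \<open>s v powr (2 * p) * (cmod (f v))^2\<close> equal the summand of \<open>A\<close>.\<close>
  define f where "f = (\<lambda>v. if v \<in> F then l v / complex_of_real (s v powr (2 * p)) else 0)"
  define A where "A = (\<Sum>v\<in>F. (cmod (l v))\<^sup>2 / s v powr (2 * p))"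
  have f: "f \<in> ell2 V"
    by (rule ell2_finite_support[OF F(1) FV]) (simp add: f_def)
  have U'f: "U' f \<in> ell2 V"
    by (rule linear_bounded_by_ell2[OF linear_bounded_by_shift_adjoint f])
  have "U' f u = (\<Sum>\<^sub>\<infinity>v\<in>F. cnj (l v) / complex_of_real (s u) * f v)"
    unfolding shift_adjoint_eq[OF u(1)]
    by (rule infsum_cong_neutral) (use FChi in \<open>auto simp: f_def\<close>)
  also have "\<dots> = (\<Sum>v\<in>F. complex_of_real ((cmod (l v))\<^sup>2 / s v powr (2 * p) / s u))"
    using F(1) by (auto intro!: sum.cong simp: f_def complex_norm_square mult_ac
        simp del: of_real_power)
  also have "\<dots> = complex_of_real (A / s u)"
    by (simp add: A_def sum_divide_distrib)
  finally have "cmod (U' f u) = \<bar>A / s u\<bar>"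
    by (simp only: norm_of_real)
  then have "s u powr (2 * p) * (A\<^sup>2 / (s u)\<^sup>2) = (\<Sum>x\<in>{u}. s x powr (2 * p) * (cmod (U' f x))\<^sup>2)"
    by (simp add: power_divide)
  also have "\<dots> \<le> (\<Sum>\<^sub>\<infinity>x\<in>V. s x powr (2 * p) * (cmod (U' f x))\<^sup>2)"
    by (rule finite_sum_le_infsum[OF summable_weighted_ell2[OF U'f abs_s_powr_le]])
      (use u assms(1) in auto)
  also have "\<dots> \<le> (\<Sum>\<^sub>\<infinity>x\<in>V. s x powr (2 * p) * (cmod (f x))\<^sup>2)"
    using assms(2) f unfolding p_hyponormal_iff_quadratic_form[OF assms(1)] by blast
  also have "\<dots> = (\<Sum>\<^sub>\<infinity>x\<in>F. s x powr (2 * p) * (cmod (f x))\<^sup>2)"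
    by (rule infsum_cong_neutral) (use FV in \<open>auto simp: f_def\<close>)
  also have "\<dots> = A"
    using F(1) sF by (auto intro!: sum.cong simp: f_def A_def norm_divide power_divide
        power2_eq_square)
  finally have "s u powr (2 * (p - 1)) * A * A \<le> 1 * A"
    unfolding s_powr_diff[OF u(2)] by (simp add: power2_eq_square mult.assoc)
  moreover have "A \<ge> 0"
    unfolding A_def by (intro sum_nonneg) auto
  \<comment> \<open>For \<open>A = 0\<close> the claim is trivial; otherwise \<open>A\<close> is
    positive and cancels.\<close>
  ultimately show ?thesis
    unfolding A_def[symmetric] by (cases "A = 0") (auto simp: mult_le_cancel_right)
qed

text \<open>
  The Cauchy--Schwarz inequality is applied to the factorisation
  \<open>(cnj (l v) / (s u * s v powr p)) * (s v powr p * f v)\<close> of the terms of \<open>U' f u\<close>.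
\<close>

lemma p_hyponormalI:
  assumes "p > 0"
    and zero: "\<And>u v. v \<in> Chi V E u \<Longrightarrow> s v = 0 \<Longrightarrow> l v = 0"
    and sum_le: "\<And>u F. u \<in> V_plus V E l \<Longrightarrow> finite F \<Longrightarrow> F \<subseteq> Chi_plus V E l u \<Longrightarrow>
      s u powr (2 * (p - 1)) * (\<Sum>v\<in>F. (cmod (l v))\<^sup>2 / s v powr (2 * p)) \<le> 1"
  shows "p_hyponormal V p (weighted_shift V E l)"
  unfolding p_hyponormal_iff_quadratic_form[OF assms(1)]
proof
  fix f assume f: "f \<in> ell2 V"
  define g where "g = (\<lambda>v. s v powr (2 * p) * (cmod (f v))\<^sup>2)"
  have g: "g summable_on V"
    unfolding g_def by (rule summable_weighted_ell2[OF f abs_s_powr_le]) (use assms(1) in auto)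
  have U'f: "U' f \<in> ell2 V"
    by (rule linear_bounded_by_ell2[OF linear_bounded_by_shift_adjoint f])
  have local: "s u powr (2 * p) * (cmod (U' f u))\<^sup>2 \<le> (\<Sum>\<^sub>\<infinity>v\<in>Chi V E u. g v)" if u: "u \<in> V" for u
  proof (cases "s u = 0")
    case True
    then show ?thesis by (auto simp: g_def intro: infsum_nonneg)
  next
    case False
    define a where "a = (\<lambda>v. cnj (l v) / complex_of_real (s u * s v powr p))"
    define b where "b = (\<lambda>v. complex_of_real (s v powr p) * f v)"
    \<comment> \<open>The sum of the squares of \<open>cmod (a v)\<close> will be
      \<open>A / (s u)^2\<close>, and the hypothesis says
      \<open>s u powr (2 * p) / (s u)^2 * A \<le> 1\<close>.\<close>
    define K where "K = 1 / s u powr (2 * p)"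
    have K: "(\<Sum>v\<in>F. (cmod (a v))\<^sup>2) \<le> K" if F: "finite F" "F \<subseteq> Chi V E u" for F
    proof -
      define A where "A = (\<Sum>v\<in>F \<inter> Chi_plus V E l u. (cmod (l v))\<^sup>2 / s v powr (2 * p))"
      have "(\<Sum>v\<in>F. (cmod (a v))\<^sup>2) = (\<Sum>v\<in>F. (cmod (l v))\<^sup>2 / s v powr (2 * p)) / (s u)\<^sup>2"
        by (simp add: a_def norm_divide norm_mult power_divide power_mult_distrib s_powr_power2
            sum_divide_distrib mult.commute)
      \<comment> \<open>Children with \<open>s v = 0\<close> have weight 0 by the first condition,
        so only those in \<open>Chi_plus\<close> contribute.\<close>
      also have "(\<Sum>v\<in>F. (cmod (l v))\<^sup>2 / s v powr (2 * p)) = A"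
        unfolding A_def
        by (rule sum.mono_neutral_right)
            (use F Chi_subset[of u] zero in \<open>auto simp: Chi_plus_def V_plus_iff\<close>)
      finally have eq: "(\<Sum>v\<in>F. (cmod (a v))\<^sup>2) = A / (s u)\<^sup>2" .
      have "s u powr (2 * (p - 1)) * A \<le> 1"
        unfolding A_def by (rule sum_le) (use u False F in \<open>auto simp: V_plus_iff\<close>)
      then show ?thesis
        unfolding eq K_def s_powr_diff[OF False] using False s_nonneg[of u]
        by (simp add: field_simps)
    qed
    have a_summable: "(\<lambda>v. (cmod (a v))\<^sup>2) summable_on Chi V E u"
      by (rule nonneg_bdd_above_summable_on) (auto intro!: bdd_aboveI2[of _ _ K] K)
    have b_eq: "(\<lambda>v. (cmod (b v))\<^sup>2) = g"
      by (simp add: b_def g_def norm_mult power_mult_distrib s_powr_power2)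
    have b_summable: "(\<lambda>v. (cmod (b v))\<^sup>2) summable_on Chi V E u"
      unfolding b_eq by (rule summable_on_subset_banach[OF g Chi_subset])
    \<comment> \<open>The factorisation divides by \<open>s v powr p\<close>; where that is zero,
      both terms vanish because \<open>l v\<close> does.\<close>
    have "U' f u = (\<Sum>\<^sub>\<infinity>v\<in>Chi V E u. a v * b v)"
      unfolding shift_adjoint_eq[OF u]
      by (rule infsum_cong) (use zero in \<open>auto simp: a_def b_def\<close>)
    then have "(cmod (U' f u))\<^sup>2 \<le> (\<Sum>\<^sub>\<infinity>v\<in>Chi V E u. (cmod (a v))\<^sup>2) * (\<Sum>\<^sub>\<infinity>v\<in>Chi V E u. g v)"
      using infsum_Cauchy_Schwarz(2)[OF a_summable b_summable] by (simp add: b_eq)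
    also have "\<dots> \<le> K * (\<Sum>\<^sub>\<infinity>v\<in>Chi V E u. g v)"
      by (intro mult_right_mono infsum_le_finite_sums[OF a_summable K] infsum_nonneg)
        (auto simp: g_def)
    finally show ?thesis
      using False s_nonneg[of u] by (simp add: K_def field_simps)
  qed
  have "(\<Sum>\<^sub>\<infinity>u\<in>V. s u powr (2 * p) * (cmod (U' f u))\<^sup>2) \<le> (\<Sum>\<^sub>\<infinity>v\<in>V. g v)"
  proof (rule infsum_le_finite_sums)
    show "(\<lambda>u. s u powr (2 * p) * (cmod (U' f u))\<^sup>2) summable_on V"
      by (rule summable_weighted_ell2[OF U'f abs_s_powr_le]) (use assms(1) in auto)
    fix F assume F: "finite F" "F \<subseteq> V"
    have "(\<Sum>u\<in>F. s u powr (2 * p) * (cmod (U' f u))\<^sup>2) \<le> (\<Sum>u\<in>F. \<Sum>\<^sub>\<infinity>v\<in>Chi V E u. g v)"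
      by (intro sum_mono local) (use F in auto)
    also have "\<dots> \<le> (\<Sum>\<^sub>\<infinity>v\<in>V. g v)"
      by (rule sum_infsum_Chi_le[OF g _ F]) (simp add: g_def)
    finally show "(\<Sum>u\<in>F. s u powr (2 * p) * (cmod (U' f u))\<^sup>2) \<le> (\<Sum>\<^sub>\<infinity>v\<in>V. g v)" .
  qed
  then show "(\<Sum>\<^sub>\<infinity>u\<in>V. s u powr (2 * p) * (cmod (U' f u))\<^sup>2) \<le>
      (\<Sum>\<^sub>\<infinity>v\<in>V. s v powr (2 * p) * (cmod (f v))\<^sup>2)"
    by (simp add: g_def)
qed

end

(* The sum over the children is taken in ennreal: it may diverge, and a divergent
   real infsum would be 0. *)
theorem theorem8p2p1:
  fixes V :: "'v set" and E :: "('v \<times> 'v) set"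
    and l :: "'v \<Rightarrow> complex" and p :: real
  assumes "directed_tree V E"
    and "shift_domain V E l = ell2 V"
    and "weighted_shift V E l \<in> bounded_ops V"
    and "p > 0"
  shows "p_hyponormal V p (weighted_shift V E l) \<longleftrightarrow>
    (\<forall>u\<in>V. \<forall>v\<in>Chi V E u. shift_norm V E l v = 0 \<longrightarrow> l v = 0) \<and>
    (\<forall>u\<in>V_plus V E l.
       ennreal (shift_norm V E l u powr (2 * (p - 1))) *
         (\<Sum>\<^sub>\<infinity>v\<in>Chi_plus V E l u.
            ennreal ((cmod (l v))\<^sup>2 / shift_norm V E l v powr (2 * p))) \<le> 1)"
proof -
  interpret bounded_weighted_shift V E l
    using assms(1-3) by (simp add: bounded_weighted_shift_def bounded_weighted_shift_axioms_def)
  \<comment> \<open>The equivalence is first proved with the series condition stated over finite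
    sets of children, the form that both directions work with.\<close>
  have "p_hyponormal V p (weighted_shift V E l) \<longleftrightarrow>
    (\<forall>u\<in>V. \<forall>v\<in>Chi V E u. s v = 0 \<longrightarrow> l v = 0) \<and>
    (\<forall>u\<in>V_plus V E l. \<forall>F. finite F \<longrightarrow> F \<subseteq> Chi_plus V E l u \<longrightarrow>
      s u powr (2 * (p - 1)) * (\<Sum>v\<in>F. (cmod (l v))\<^sup>2 / s v powr (2 * p)) \<le> 1)"
  proof (intro iffI conjI ballI allI impI)
    assume cond: "(\<forall>u\<in>V. \<forall>v\<in>Chi V E u. s v = 0 \<longrightarrow> l v = 0) \<and>
      (\<forall>u\<in>V_plus V E l. \<forall>F. finite F \<longrightarrow> F \<subseteq> Chi_plus V E l u \<longrightarrow>
        s u powr (2 * (p - 1)) * (\<Sum>v\<in>F. (cmod (l v))\<^sup>2 / s v powr (2 * p)) \<le> 1)"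
    show "p_hyponormal V p (weighted_shift V E l)"
    proof (rule p_hyponormalI[OF assms(4)])
      show "l v = 0" if "v \<in> Chi V E u" "s v = 0" for u v
        using cond that edges unfolding Chi_def by blast
    qed (use cond in blast)
  qed (use weight_eq_0_of_p_hyponormal[OF assms(4)] sum_le_one_of_p_hyponormal[OF assms(4)]
      in blast)+
  then show ?thesis
    by (simp add: ennreal_mult_infsum_le_one_iff)
qed

end
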